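(* Let $\mathcal M$ be a compact connected Riemannian manifold without boundary, let $\gamma>0$, and let $W:\mathcal M\times\mathcal M\to\mathbb R$ be continuous with $W(x,y)=W(y,x)$. Then the free energy $\mathcal F_\gamma$ has at least one minimizer $\mu^*\in\arg\min_{\mu\in\mathcal P(\mathcal M)}\mathcal F_\gamma(\mu)$ in the space of probability measures $\mathcal P(\mathcal M)$. Moreover, every minimizer $\mu^*$ admits a density with respect to the normalized volume measure, $d\mu^*=\rho^*dm$, and $\rho^*\in L_2(\mathcal M)$.
   Context: $m$ is the Riemannian volume measure normalized so that $m(\mathcal M)=1$. The free energy is $\mathcal F_\gamma(\mu)=\gamma^{-1}\mathcal E(\mu)+\mathcal I(\mu)$, where $\mathcal E(\mu)=\int_{\mathcal M}\rho\log\rho\,dm$ if $\mu$ admits a positive density $\rho$ with respect to $m$ and $\mathcal E(\mu)=+\infty$ otherwise, and $\mathcal I(\mu)=\frac12\int_{\mathcal M\times\mathcal M}W(x,y)\,d\mu(x)d\mu(y)$. *)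

theory Defs
  imports "HOL-Probability.Probability"
begin

section \<open>Smooth maps between Euclidean spaces\<close>

text \<open>Meant for open domains, where the within-derivative is the ordinary derivative.\<close>

primrec C_k_on :: "nat \<Rightarrow> 'a::euclidean_space set \<Rightarrow> ('a \<Rightarrow> 'b::real_normed_vector) \<Rightarrow> bool" where
  "C_k_on 0 S f \<longleftrightarrow> continuous_on S f"
| "C_k_on (Suc k) S f \<longleftrightarrow>
     f differentiable_on S \<and> (\<forall>v. C_k_on k S (\<lambda>x. frechet_derivative f (at x) v))"

definition smooth_on :: "'a::euclidean_space set \<Rightarrow> ('a \<Rightarrow> 'b::real_normed_vector) \<Rightarrow> bool" where
  "smooth_on S f \<longleftrightarrow> (\<forall>k. C_k_on k S f)"


section \<open>Riemannian manifolds without boundary\<close>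

text \<open>A manifold is a Hausdorff second countable type together with a smooth atlas.
  A chart is its domain together with its coordinate map, whose values outside the domain are
  irrelevant. Charts map onto open subsets of the full space, so there is no boundary.\<close>

type_synonym ('a, 'n) chart = "'a set \<times> ('a \<Rightarrow> real ^ 'n)"

abbreviation chart_dom :: "('a, 'n) chart \<Rightarrow> 'a set" where
  "chart_dom c \<equiv> fst c"

abbreviation coord :: "('a, 'n) chart \<Rightarrow> 'a \<Rightarrow> real ^ 'n" where
  "coord c \<equiv> snd c"

abbreviation param :: "('a, 'n) chart \<Rightarrow> real ^ 'n \<Rightarrow> 'a" where
  "param c \<equiv> inv_into (chart_dom c) (coord c)"

definition is_chart :: "('a::topological_space, 'n::finite) chart \<Rightarrow> bool" where
  "is_chart c \<longleftrightarrow>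
     open (chart_dom c) \<and> open (coord c ` chart_dom c) \<and>
     homeomorphism (chart_dom c) (coord c ` chart_dom c) (coord c) (param c)"

definition smooth_atlas ::
  "('a::{t2_space, second_countable_topology}, 'n::finite) chart set \<Rightarrow> bool" where
  "smooth_atlas \<A> \<longleftrightarrow>
     (\<forall>c\<in>\<A>. is_chart c) \<and>
     (\<Union>c\<in>\<A>. chart_dom c) = UNIV \<and>
     (\<forall>c\<in>\<A>. \<forall>d\<in>\<A>.
        smooth_on (coord c ` (chart_dom c \<inter> chart_dom d)) (coord d \<circ> param c))"

definition transition_jacobian ::
  "('a, 'n::finite) chart \<Rightarrow> ('a, 'n) chart \<Rightarrow> 'a \<Rightarrow> real ^ 'n ^ 'n" where
  "transition_jacobian c d p = matrix (frechet_derivative (coord d \<circ> param c) (at (coord c p)))"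

text \<open>The metric is given by its components: \<open>g c p\<close> is the Gram matrix at the point \<open>p\<close> of the
  coordinate frame of the chart \<open>c\<close>. The last clause is the transformation law of a covariant
  2-tensor, which makes the inner product on the tangent space at \<open>p\<close> independent of the chart.\<close>

definition riemannian_metric ::
  "('a::{t2_space, second_countable_topology}, 'n::finite) chart set
     \<Rightarrow> (('a, 'n) chart \<Rightarrow> 'a \<Rightarrow> real ^ 'n ^ 'n) \<Rightarrow> bool" where
  "riemannian_metric \<A> g \<longleftrightarrow>
     (\<forall>c\<in>\<A>. smooth_on (coord c ` chart_dom c) (g c \<circ> param c)) \<and>
     (\<forall>c\<in>\<A>. \<forall>p\<in>chart_dom c.
        transpose (g c p) = g c p \<and> (\<forall>v. v \<noteq> 0 \<longrightarrow> 0 < v \<bullet> (g c p *v v))) \<and>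
     (\<forall>c\<in>\<A>. \<forall>d\<in>\<A>. \<forall>p\<in>chart_dom c \<inter> chart_dom d.
        g c p = transpose (transition_jacobian c d p) ** g d p ** transition_jacobian c d p)"

definition compact_connected_riemannian_manifold ::
  "('a::{t2_space, second_countable_topology}, 'n::finite) chart set
     \<Rightarrow> (('a, 'n) chart \<Rightarrow> 'a \<Rightarrow> real ^ 'n ^ 'n) \<Rightarrow> bool" where
  "compact_connected_riemannian_manifold \<A> g \<longleftrightarrow>
     smooth_atlas \<A> \<and> riemannian_metric \<A> g \<and>
     compact (UNIV :: 'a set) \<and> connected (UNIV :: 'a set)"

text \<open>The Riemannian volume is the unique Borel measure that equals
  \<open>sqrt (det g) dx\<^sub>1 \<dots> dx\<^sub>n\<close> in the coordinates of each chart.\<close>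

definition is_riemannian_volume ::
  "('a::{t2_space, second_countable_topology}, 'n::finite) chart set
     \<Rightarrow> (('a, 'n) chart \<Rightarrow> 'a \<Rightarrow> real ^ 'n ^ 'n) \<Rightarrow> 'a measure \<Rightarrow> bool" where
  "is_riemannian_volume \<A> g vol \<longleftrightarrow>
     sets vol = sets borel \<and>
     (\<forall>c\<in>\<A>. \<forall>B\<in>sets borel. B \<subseteq> chart_dom c \<longrightarrow>
        emeasure vol B =
          (\<integral>\<^sup>+ x \<in> coord c ` B. ennreal (sqrt (det (g c (param c x)))) \<partial>lborel))"

abbreviation normalized_measure :: "'a measure \<Rightarrow> 'a measure" where
  "normalized_measure M \<equiv> uniform_measure M (space M)"


section \<open>The free energy\<close>

definition prob_measures :: "'a::topological_space measure set" where
  "prob_measures = {\<mu>. prob_space \<mu> \<and> sets \<mu> = sets borel}"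

definition has_density :: "'a measure \<Rightarrow> 'a measure \<Rightarrow> ('a \<Rightarrow> real) \<Rightarrow> bool" where
  "has_density m \<mu> \<rho> \<longleftrightarrow>
     \<rho> \<in> borel_measurable m \<and> (AE x in m. 0 \<le> \<rho> x) \<and> \<mu> = density m (\<lambda>x. ennreal (\<rho> x))"

definition has_positive_density :: "'a measure \<Rightarrow> 'a measure \<Rightarrow> ('a \<Rightarrow> real) \<Rightarrow> bool" where
  "has_positive_density m \<mu> \<rho> \<longleftrightarrow> has_density m \<mu> \<rho> \<and> (AE x in m. 0 < \<rho> x)"

text \<open>The Bochner integral of a non-integrable function is 0 by convention, so the possible value
  \<open>\<infinity>\<close> of the entropy integral needs an extended integral. For finite \<open>m\<close> the negative part of
  \<open>\<rho> log \<rho>\<close> is integrable, and the difference below is never \<open>\<infinity> - \<infinity>\<close>.\<close>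

definition extended_integral :: "'a measure \<Rightarrow> ('a \<Rightarrow> real) \<Rightarrow> ereal" where
  "extended_integral m f =
     enn2ereal (\<integral>\<^sup>+ x. ennreal (f x) \<partial>m) - enn2ereal (\<integral>\<^sup>+ x. ennreal (- f x) \<partial>m)"

text \<open>The density is unique almost everywhere, so the value does not depend on the choice.\<close>

definition entropy_functional :: "'a measure \<Rightarrow> 'a measure \<Rightarrow> ereal" where
  "entropy_functional m \<mu> =
     (if \<exists>\<rho>. has_positive_density m \<mu> \<rho>
      then let \<rho> = (SOME \<rho>. has_positive_density m \<mu> \<rho>)
           in extended_integral m (\<lambda>x. \<rho> x * ln (\<rho> x))
      else \<infinity>)"

definition interaction_energy :: "('a \<times> 'a \<Rightarrow> real) \<Rightarrow> 'a measure \<Rightarrow> real" where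
  "interaction_energy W \<mu> = 1 / 2 * (\<integral>z. W z \<partial>(\<mu> \<Otimes>\<^sub>M \<mu>))"

definition free_energy ::
  "'a measure \<Rightarrow> ('a \<times> 'a \<Rightarrow> real) \<Rightarrow> real \<Rightarrow> 'a measure \<Rightarrow> ereal" where
  "free_energy m W \<gamma> \<mu> =
     ereal (inverse \<gamma>) * entropy_functional m \<mu> + ereal (interaction_energy W \<mu>)"

end

theory Submission
  imports Defs "HOL-Complex_Analysis.Great_Picard"
begin

text \<open>
  The free energy is not convex, because \<open>W\<close> need not be positive definite. Existence of a minimizer
  still follows without weak compactness of measures, from two facts that compensate each other.
  The entropy is strongly convex: passing from \<open>\<rho>\<close> and \<open>\<sigma>\<close> to the midpoint lowers the mean entropy
  by at least a quarter of \<open>\<integral> (\<surd>\<rho> - \<surd>\<sigma>)\<^sup>2 dm\<close>, the squared Hellinger distance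
  (\<open>admissible_mixture\<close>). The interaction is almost affine along pairs of densities with uniformly
  close potentials \<open>\<integral> W(x,y) \<rho>(y) dm(y)\<close>, and since these potentials are uniformly bounded and
  equicontinuous on a compact space, every sequence of densities has a subsequence with uniformly
  Cauchy potentials (\<open>uniformly_Cauchy_potentials\<close>). Along such a subsequence of a minimizing
  sequence, midpoints would fall below the infimum unless the Hellinger distances tend to \<open>0\<close>.
  So the subsequence converges in \<open>L\<^sub>1\<close>, the entropy is lower semicontinuous by Fatou, the
  interaction is continuous, and the limit is a minimizing density (\<open>minimizing_density_exists\<close>).

  This limit is a minimizer in the class of nonnegative densities, whereas the entropy of a measure
  is finite only if its density is positive. Both positivity and square integrability come from an
  explicit description of the minimizers. For a fixed external potential \<open>V\<close> the linearized
  functional \<open>\<integral> \<rho> ln \<rho> dm + \<gamma> \<integral> V \<rho> dm\<close> is minimized by the Gibbs density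
  \<open>exp (- \<gamma> V) / Z\<close>, with a gap of at least the squared Hellinger distance
  (\<open>gibbs_variational_gap\<close>). Moving a minimizing density \<open>\<rho>\<close> slightly towards the Gibbs density of
  its own potential changes the free energy by the change of this functional up to a term
  of second order, so the gap must vanish and \<open>\<rho>\<close> equals that Gibbs density almost everywhere
  (\<open>minimizing_density_eq_gibbs\<close>). As \<open>V\<close> is bounded, \<open>\<rho>\<close> is bounded and positive.

  Geometry enters only through the normalization: compactness makes the Riemannian volume finite,
  and positive definiteness of the metric makes it nonzero (\<open>normalized_riemannian_volume\<close>).
\<close>

section \<open>Finiteness and positivity of the Riemannian volume\<close>

text \<open>On the segment from the identity to \<open>A\<close> all matrices are positive definite, hence injective, so the
  determinant cannot change its sign.\<close>

lemma pos_def_matrix_det_pos: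
  fixes A :: "real ^ 'n ^ 'n"
  assumes pos: "\<And>v. v \<noteq> 0 \<Longrightarrow> 0 < v \<bullet> (A *v v)"
  shows "0 < det A"
proof (rule ccontr)
  assume neg: "\<not> 0 < det A"
  define B where "B = (\<lambda>t::real. (1 - t) *\<^sub>R mat 1 + t *\<^sub>R A)"
  have "continuous_on {0..1} (\<lambda>t. det (B t))"
    unfolding B_def det_def by (simp, intro continuous_intros)
  moreover have "det (B 0) = 1" "det (B 1) = det A"
    by (simp_all add: B_def)
  ultimately obtain t where t: "0 \<le> t" "t \<le> 1" "det (B t) = 0"
    using IVT2'[of "\<lambda>t. det (B t)" 1 0 0] neg by auto
  then obtain v where v: "v \<noteq> 0" "B t *v v = 0"
    by (meson invertible_det_nz invertible_left_inverse matrix_left_invertible_ker)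
  have "v \<bullet> (B t *v v) = (1 - t) * (v \<bullet> v) + t * (v \<bullet> (A *v v))"
    by (simp add: B_def matrix_vector_mult_add_rdistrib scaleR_matrix_vector_assoc[symmetric] inner_add_right)
  moreover have "0 < v \<bullet> v" "0 < v \<bullet> (A *v v)"
    using v pos by auto
  then have "0 < (1 - t) * (v \<bullet> v) + t * (v \<bullet> (A *v v))"
    using t by (cases "t = 0") (auto intro!: add_nonneg_pos mult_nonneg_nonneg)
  ultimately show False
    using v by simp
qed

lemma continuous_on_det:
  fixes f :: "'b::topological_space \<Rightarrow> real ^ 'n ^ 'n"
  assumes "continuous_on S f"
  shows "continuous_on S (\<lambda>x. det (f x))"
  unfolding det_def using assms by (intro continuous_intros)

text \<open>In a chart, a closed coordinate ball is compact, so the volume density \<open>\<surd>(det g)\<close> lies there between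
  two positive constants, and the volume of the ball is comparable to its Lebesgue measure.\<close>

lemma riemannian_volume_chart_ball:
  fixes \<A> :: "('a::{t2_space, second_countable_topology}, 'n::finite) chart set"
  assumes "smooth_atlas \<A>" "riemannian_metric \<A> g" "is_riemannian_volume \<A> g vol"
  shows "\<exists>U. open U \<and> p \<in> U \<and> 0 < emeasure vol U \<and> emeasure vol U < \<infinity>"
proof -
  obtain c where c: "c \<in> \<A>" "p \<in> chart_dom c"
    using assms(1) unfolding smooth_atlas_def by blast
  then have chart: "is_chart c"
    using assms(1) unfolding smooth_atlas_def by blast
  define O' where "O' = coord c ` chart_dom c"
  have O': "open O'" "coord c p \<in> O'" and dom: "open (chart_dom c)"
    and hom: "homeomorphism (chart_dom c) O' (coord c) (param c)"
    using chart c unfolding is_chart_def O'_def by auto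
  obtain r where r: "0 < r" "cball (coord c p) r \<subseteq> O'"
    using O' open_contains_cball by blast
  define h where "h = (\<lambda>x. sqrt (det (g c (param c x))))"
  have "smooth_on O' (g c \<circ> param c)"
    using assms(2) c unfolding riemannian_metric_def O'_def by blast
  then have "continuous_on O' (g c \<circ> param c)"
    unfolding smooth_on_def by (metis C_k_on.simps(1))
  then have "continuous_on (cball (coord c p) r) (\<lambda>x. g c (param c x))"
    using r(2) continuous_on_subset by (auto simp: o_def)
  then have h_cont: "continuous_on (cball (coord c p) r) h"
    unfolding h_def by (intro continuous_intros continuous_on_det)
  have h_pos: "0 < h x" if "x \<in> O'" for x
  proof -
    have "param c x \<in> chart_dom c"
      using that hom unfolding homeomorphism_def by blast
    then have "\<And>v. v \<noteq> 0 \<Longrightarrow> 0 < v \<bullet> (g c (param c x) *v v)"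
      using assms(2) c unfolding riemannian_metric_def by blast
    then show ?thesis
      unfolding h_def by (simp add: pos_def_matrix_det_pos)
  qed
  have ne: "cball (coord c p) r \<noteq> {}"
    using r by auto
  \<comment> \<open>The volume density attains its bounds on the closed ball; the bounds serve on the open one.\<close>
  obtain x0 where x0: "x0 \<in> cball (coord c p) r" "\<And>x. x \<in> cball (coord c p) r \<Longrightarrow> h x0 \<le> h x"
    using continuous_attains_inf[OF compact_cball ne h_cont] by blast
  obtain x1 where x1: "\<And>x. x \<in> cball (coord c p) r \<Longrightarrow> h x \<le> h x1"
    using continuous_attains_sup[OF compact_cball ne h_cont] by blast
  define U where "U = chart_dom c \<inter> coord c -` ball (coord c p) r"
  have "continuous_on (chart_dom c) (coord c)"
    using hom unfolding homeomorphism_def by blast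
  then have U_open: "open U"
    unfolding U_def using dom by (intro continuous_open_preimage) auto
  have "ball (coord c p) r \<subseteq> O'"
    using r ball_subset_cball by blast
  then have image: "coord c ` U = ball (coord c p) r"
    unfolding U_def O'_def by auto
  let ?b = "ball (coord c p) r"
  have "emeasure vol U = (\<integral>\<^sup>+ x \<in> ?b. ennreal (h x) \<partial>lborel)"
    using assms(3) c(1) U_open image unfolding is_riemannian_volume_def h_def U_def by fastforce
  moreover have "(\<integral>\<^sup>+ x \<in> ?b. ennreal (h x) \<partial>lborel) \<le> (\<integral>\<^sup>+ x \<in> ?b. ennreal (h x1) \<partial>lborel)"
    using x1 by (intro nn_integral_mono) (auto split: split_indicator intro!: ennreal_leI)
  moreover have "(\<integral>\<^sup>+ x \<in> ?b. ennreal (h x0) \<partial>lborel) \<le> (\<integral>\<^sup>+ x \<in> ?b. ennreal (h x) \<partial>lborel)"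
    using x0 by (intro nn_integral_mono) (auto split: split_indicator intro!: ennreal_leI)
  moreover have "(\<integral>\<^sup>+ x \<in> ?b. ennreal (h x1) \<partial>lborel) < \<infinity>"
    using emeasure_bounded_finite[OF bounded_ball]
    by (auto simp: nn_integral_cmult_indicator ennreal_mult_less_top)
  moreover have "0 < h x0"
    using x0 r h_pos by blast
  then have "0 < (\<integral>\<^sup>+ x \<in> ?b. ennreal (h x0) \<partial>lborel)"
    using r open_not_negligible[of ?b]
    by (auto simp: nn_integral_cmult_indicator ennreal_zero_less_mult_iff zero_less_iff_neq_zero
        negligible_iff_emeasure0)
  ultimately show ?thesis
    using U_open c r by (intro exI[of _ U]) (auto simp: U_def)
qed

lemma normalized_riemannian_volume:
  fixes \<A> :: "('a::{t2_space, second_countable_topology}, 'n::finite) chart set"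
  assumes manifold: "compact_connected_riemannian_manifold \<A> g"
    and volume: "is_riemannian_volume \<A> g vol"
  shows "prob_space (normalized_measure vol)" "sets (normalized_measure vol) = sets borel"
proof -
  have sets: "sets vol = sets borel"
    using volume unfolding is_riemannian_volume_def by blast
  then have space: "space vol = UNIV"
    using sets_eq_imp_space_eq by fastforce
  have compact: "compact (UNIV :: 'a set)"
    using manifold unfolding compact_connected_riemannian_manifold_def by blast
  have "\<exists>U. open U \<and> p \<in> U \<and> 0 < emeasure vol U \<and> emeasure vol U < \<infinity>" for p
    using manifold volume riemannian_volume_chart_ball
    unfolding compact_connected_riemannian_manifold_def by blast
  then obtain U where U: "\<And>p. open (U p)" "\<And>p. p \<in> U p"
      "\<And>p. 0 < emeasure vol (U p)" "\<And>p. emeasure vol (U p) < \<infinity>"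
    by metis
  obtain F where F: "finite F" "UNIV \<subseteq> (\<Union>p\<in>F. U p)"
    using compactE_image[OF compact, of UNIV U] U by (metis UNIV_eq_I UN_iff UNIV_I subset_UNIV)
  have "emeasure vol UNIV \<le> emeasure vol (\<Union>p\<in>F. U p)"
    using F U sets by (intro emeasure_mono) auto
  also have "\<dots> \<le> (\<Sum>p\<in>F. emeasure vol (U p))"
    using F U sets by (intro emeasure_subadditive_finite) auto
  also have "\<dots> < \<infinity>"
    using U F by simp
  finally have "emeasure vol UNIV \<noteq> \<infinity>"
    by simp
  moreover have "0 < emeasure vol UNIV"
    using U(3) emeasure_mono[of "U _" UNIV vol] sets by (metis less_le_trans sets.top space subset_UNIV)
  ultimately show "prob_space (normalized_measure vol)"
    using space by (intro prob_space_uniform_measure) auto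
  show "sets (normalized_measure vol) = sets borel"
    using sets by simp
qed

section \<open>Strong convexity of the entropy density\<close>

text \<open>The left side without the square is the tangent of \<open>a ln a\<close> at \<open>m\<close>. The square is what remains of the
  relative entropy integrand \<open>a ln (a / m) - a + m\<close> after estimating
  \<open>ln (m / a) = 2 ln \<surd>(m / a) \<le> 2 (\<surd>(m / a) - 1)\<close>. Both strong convexity and the Gibbs variational
  principle are integrated forms of this bound.\<close>

lemma entropy_tangent_gap:
  fixes a m :: real
  assumes "0 \<le> a" "0 < m"
  shows "m * ln m + (ln m + 1) * (a - m) + (sqrt a - sqrt m)\<^sup>2 \<le> a * ln a"
proof (cases "a = 0")
  case True
  then show ?thesis
    using assms by (simp add: algebra_simps)
next
  case False
  then have a: "0 < a"
    using assms by simp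
  define u v where "u = sqrt a" and "v = sqrt m"
  have uv: "0 < u" "0 < v" "a = u\<^sup>2" "m = v\<^sup>2"
    using a assms by (auto simp: u_def v_def)
  have "ln v - ln u \<le> v / u - 1"
    using ln_le_minus_one[of "v / u"] uv by (simp add: ln_div)
  then have "2 * u\<^sup>2 * (ln v - ln u) \<le> 2 * u\<^sup>2 * (v / u - 1)"
    by (intro mult_left_mono) auto
  also have "\<dots> = 2 * u * v - 2 * u\<^sup>2"
    using uv by (simp add: field_simps power2_eq_square)
  finally have "2 * u\<^sup>2 * (ln v - ln u) \<le> 2 * u * v - 2 * u\<^sup>2" .
  moreover have "ln a = 2 * ln u" "ln m = 2 * ln v"
    using uv by (auto simp: ln_realpow)
  ultimately show ?thesis
    using uv unfolding u_def[symmetric] v_def[symmetric]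
    by (simp add: power2_eq_square algebra_simps)
qed

text \<open>Averaging the tangent bounds at the mixture cancels the linear terms. The averaged squares are at least
  \<open>t (1 - t) (\<surd>a - \<surd>b)\<^sup>2\<close>, the variance of the two square roots.\<close>

lemma entropy_convexity_gap:
  fixes a b t :: real
  assumes "0 \<le> a" "0 \<le> b" "0 \<le> t" "t \<le> 1"
  shows "((1 - t) * a + t * b) * ln ((1 - t) * a + t * b) + t * (1 - t) * (sqrt a - sqrt b)\<^sup>2
    \<le> (1 - t) * (a * ln a) + t * (b * ln b)"
proof (cases "(1 - t) * a + t * b = 0")
  case True
  then have "(1 - t) * a = 0" "t * b = 0"
    using assms by (smt (verit) mult_nonneg_nonneg)+
  then show ?thesis
    by auto
next
  case False
  define m where "m = (1 - t) * a + t * b"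
  have "0 < m"
    using False assms unfolding m_def by (smt (verit) mult_nonneg_nonneg)
  define u v w where "u = sqrt a" and "v = sqrt b" and "w = sqrt m"
  have "(1 - t) * (m * ln m + (ln m + 1) * (a - m) + (u - w)\<^sup>2)
      + t * (m * ln m + (ln m + 1) * (b - m) + (v - w)\<^sup>2) \<le> (1 - t) * (a * ln a) + t * (b * ln b)"
    unfolding u_def v_def w_def using assms \<open>0 < m\<close>
    by (intro add_mono mult_left_mono entropy_tangent_gap) auto
  moreover have "(1 - t) * (m * ln m + (ln m + 1) * (a - m) + (u - w)\<^sup>2)
      + t * (m * ln m + (ln m + 1) * (b - m) + (v - w)\<^sup>2)
    = m * ln m + (ln m + 1) * ((1 - t) * a + t * b - m)
      + (t * (1 - t) * (u - v)\<^sup>2 + ((1 - t) * u + t * v - w)\<^sup>2)"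
    by (simp add: power2_eq_square algebra_simps)
  ultimately have "m * ln m + (t * (1 - t) * (u - v)\<^sup>2 + ((1 - t) * u + t * v - w)\<^sup>2)
     \<le> (1 - t) * (a * ln a) + t * (b * ln b)"
    by (simp add: m_def)
  then show ?thesis
    unfolding m_def[symmetric] u_def[symmetric] v_def[symmetric]
    by (smt (verit) zero_le_power2)
qed

lemma continuous_on_entropy_density: "continuous_on {0..} (\<lambda>x::real. x * ln x)"
  unfolding continuous_on_eq_continuous_within
proof
  fix x :: real
  assume "x \<in> {0..}"
  show "continuous (at x within {0..}) (\<lambda>x. x * ln x)"
  proof (cases "x = 0")
    case True
    have "((\<lambda>x::real. x * ln x) \<longlongrightarrow> 0) (at_right 0)"
      by real_asymp
    then show ?thesis
      using True by (simp add: continuous_within at_within_Ici_at_right)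
  next
    case False
    then show ?thesis
      by (intro continuous_intros) auto
  qed
qed

lemma entropy_density_ge: "-1 \<le> x * ln x" if "0 \<le> x" for x :: real
proof -
  have "x - 1 + (sqrt x - 1)\<^sup>2 \<le> x * ln x"
    using entropy_tangent_gap[OF that zero_less_one] by simp
  moreover have "0 \<le> (sqrt x - 1)\<^sup>2"
    by simp
  ultimately have "x - 1 \<le> x * ln x"
    by linarith
  then show ?thesis
    using that by linarith
qed

section \<open>Limit theorems for integrals\<close>

text \<open>Fatou for functions with a common lower bound \<open>-b\<close>, in a form for Bochner integrals: integrability of
  the limit is part of the conclusion.\<close>

lemma (in prob_space) fatou_bounded_below:
  fixes f :: "nat \<Rightarrow> 'a \<Rightarrow> real"
  assumes int: "\<And>n. integrable M (f n)" and ge: "\<And>n x. -b \<le> f n x"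
    and lim: "AE x in M. (\<lambda>n. f n x) \<longlonglongrightarrow> g x" and [measurable]: "g \<in> borel_measurable M"
    and L: "(\<lambda>n. \<integral>x. f n x \<partial>M) \<longlonglongrightarrow> L"
  shows "integrable M g" "(\<integral>x. g x \<partial>M) \<le> L"
proof -
  have [measurable]: "f n \<in> borel_measurable M" for n
    using int by blast
  have f_val: "(\<integral>\<^sup>+x. ennreal (f n x + b) \<partial>M) = ennreal ((\<integral>x. f n x \<partial>M) + b)" for n
  proof -
    have "(\<integral>\<^sup>+x. ennreal (f n x + b) \<partial>M) = ennreal (\<integral>x. f n x + b \<partial>M)"
    proof (intro nn_integral_eq_integral AE_I2)
      show "0 \<le> f n x + b" for x
        using ge[of n x] by linarith
    qed (use int in simp)
    then show ?thesis
      using int by (simp add: prob_space)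
  qed
  have g_ge: "AE x in M. 0 \<le> g x + b"
    using lim
  proof eventually_elim
    case (elim x)
    then have "- b \<le> g x"
      by (rule LIMSEQ_le_const) (use ge in auto)
    then show ?case
      by simp
  qed
  have "(\<integral>\<^sup>+x. ennreal (g x + b) \<partial>M) = (\<integral>\<^sup>+x. liminf (\<lambda>n. ennreal (f n x + b)) \<partial>M)"
    using lim
  proof (intro nn_integral_cong_AE, eventually_elim)
    case (elim x)
    then have "(\<lambda>n. ennreal (f n x + b)) \<longlonglongrightarrow> ennreal (g x + b)"
      by (intro tendsto_intros)
    then show ?case
      by (simp add: lim_imp_Liminf)
  qed
  also have "\<dots> \<le> liminf (\<lambda>n. \<integral>\<^sup>+x. ennreal (f n x + b) \<partial>M)"
    by (intro nn_integral_liminf) simp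
  also have "\<dots> = ennreal (L + b)"
    unfolding f_val using L by (intro lim_imp_Liminf tendsto_intros) auto
  finally have le: "(\<integral>\<^sup>+x. ennreal (g x + b) \<partial>M) \<le> ennreal (L + b)" .
  then have int': "integrable M (\<lambda>x. g x + b)"
    using g_ge by (intro integrableI_nonneg) (auto intro: le_less_trans)
  then have "integrable M (\<lambda>x. (g x + b) - b)"
    by (intro Bochner_Integration.integrable_diff) auto
  then show g_int: "integrable M g"
    by simp
  have "0 \<le> (\<integral>x. f n x \<partial>M) + b" for n
    using integral_mono[of M "\<lambda>_. - b" "f n"] int ge by (simp add: prob_space)
  then have "0 \<le> L + b"
    using LIMSEQ_le_const[OF tendsto_add[OF L tendsto_const[of b]], of 0] by auto
  moreover have "ennreal (\<integral>x. g x + b \<partial>M) \<le> ennreal (L + b)"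
    using le nn_integral_eq_integral[OF int' g_ge] by simp
  ultimately have "(\<integral>x. g x + b \<partial>M) \<le> L + b"
    by (simp add: ennreal_le_iff)
  then show "(\<integral>x. g x \<partial>M) \<le> L"
    using g_int by (simp add: prob_space)
qed

text \<open>Completeness of \<open>L\<^sub>1\<close>, with almost everywhere convergence along the same subsequence. A
  subsequence converges pointwise, and Fatou turns the Cauchy bound into convergence in norm.\<close>

lemma L1_Cauchy_limit:
  fixes s :: "nat \<Rightarrow> 'a \<Rightarrow> real"
  assumes int: "\<And>n. integrable M (s n)"
    and Cauchy: "\<And>e. 0 < e \<Longrightarrow> \<exists>N. \<forall>i\<ge>N. \<forall>j\<ge>N. (\<integral>x. \<bar>s i x - s j x\<bar> \<partial>M) < e"
  obtains r f where "strict_mono (r :: nat \<Rightarrow> nat)" "integrable M f"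
    "AE x in M. (\<lambda>i. s (r i) x) \<longlonglongrightarrow> f x" "(\<lambda>i. \<integral>x. \<bar>s (r i) x - f x\<bar> \<partial>M) \<longlonglongrightarrow> 0"
proof -
  have [measurable]: "s n \<in> borel_measurable M" for n
    using int by blast
  obtain r where r: "strict_mono (r :: nat \<Rightarrow> nat)" "AE x in M. Cauchy (\<lambda>i. s (r i) x)"
    using cauchy_L1_AE_cauchy_subseq[of M s] int Cauchy by (auto simp: real_norm_def)
  define f where "f = (\<lambda>x. lim (\<lambda>i. s (r i) x))"
  have [measurable]: "f \<in> borel_measurable M"
    unfolding f_def by (rule borel_measurable_lim_metric) simp
  have lim: "AE x in M. (\<lambda>i. s (r i) x) \<longlonglongrightarrow> f x"
    using r(2) by eventually_elim (auto simp: f_def Cauchy_convergent_iff convergent_LIMSEQ_iff)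
  have near: "\<exists>N. \<forall>i\<ge>N. integrable M (\<lambda>x. s (r i) x - f x) \<and> (\<integral>x. \<bar>s (r i) x - f x\<bar> \<partial>M) \<le> e"
    if "0 < e" for e
  proof -
    obtain N where N: "\<And>i j. N \<le> i \<Longrightarrow> N \<le> j \<Longrightarrow> (\<integral>x. \<bar>s i x - s j x\<bar> \<partial>M) < e"
      using Cauchy[OF \<open>0 < e\<close>] by blast
    have "integrable M (\<lambda>x. s (r i) x - f x) \<and> (\<integral>x. \<bar>s (r i) x - f x\<bar> \<partial>M) \<le> e" if "N \<le> i" for i
    proof -
      have "(\<integral>\<^sup>+x. ennreal \<bar>s (r i) x - f x\<bar> \<partial>M)
          = (\<integral>\<^sup>+x. liminf (\<lambda>j. ennreal \<bar>s (r i) x - s (r j) x\<bar>) \<partial>M)"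
        using lim
      proof (intro nn_integral_cong_AE, eventually_elim)
        case (elim x)
        then have "(\<lambda>j. ennreal \<bar>s (r i) x - s (r j) x\<bar>) \<longlonglongrightarrow> ennreal \<bar>s (r i) x - f x\<bar>"
          by (intro tendsto_intros)
        then show ?case
          by (intro lim_imp_Liminf[symmetric]) simp_all
      qed
      also have "\<dots> \<le> liminf (\<lambda>j. \<integral>\<^sup>+x. ennreal \<bar>s (r i) x - s (r j) x\<bar> \<partial>M)"
        by (intro nn_integral_liminf) simp
      also have "\<dots> \<le> ennreal e"
      proof (intro Liminf_le)
        have "(\<integral>\<^sup>+x. ennreal \<bar>s (r i) x - s (r j) x\<bar> \<partial>M) \<le> ennreal e" if "N \<le> j" for j
        proof -
          have "N \<le> r i" "N \<le> r j"
            using \<open>N \<le> i\<close> that seq_suble[OF r(1)] le_trans by blast+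
          then show ?thesis
            using N[of "r i" "r j"] int by (subst nn_integral_eq_integral) (auto intro!: ennreal_leI)
        qed
        then show "\<forall>\<^sub>F j in sequentially. (\<integral>\<^sup>+x. ennreal \<bar>s (r i) x - s (r j) x\<bar> \<partial>M) \<le> ennreal e"
          using eventually_sequentially by blast
      qed simp
      finally have le: "(\<integral>\<^sup>+x. ennreal \<bar>s (r i) x - f x\<bar> \<partial>M) \<le> ennreal e" .
      then have int': "integrable M (\<lambda>x. s (r i) x - f x)"
        by (intro integrableI_bounded) (auto intro: le_less_trans)
      then have "(\<integral>\<^sup>+x. ennreal \<bar>s (r i) x - f x\<bar> \<partial>M) = ennreal (\<integral>x. \<bar>s (r i) x - f x\<bar> \<partial>M)"
        by (intro nn_integral_eq_integral) auto
      then show ?thesis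
        using le int' \<open>0 < e\<close> by (simp add: ennreal_le_iff)
    qed
    then show ?thesis
      by blast
  qed
  obtain i where "integrable M (\<lambda>x. s (r i) x - f x)"
    using near[of 1] by auto
  then have "integrable M (\<lambda>x. s (r i) x - (s (r i) x - f x))"
    by (rule Bochner_Integration.integrable_diff[OF int])
  moreover have "(\<lambda>x. s (r i) x - (s (r i) x - f x)) = f"
    by auto
  ultimately have "integrable M f"
    by (simp only:)
  moreover have "(\<lambda>i. \<integral>x. \<bar>s (r i) x - f x\<bar> \<partial>M) \<longlonglongrightarrow> 0"
  proof (rule LIMSEQ_I)
    fix e :: real
    assume "0 < e"
    then obtain N where "\<And>i. N \<le> i \<Longrightarrow> (\<integral>x. \<bar>s (r i) x - f x\<bar> \<partial>M) \<le> e / 2"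
      using near[of "e / 2"] by auto
    then show "\<exists>N. \<forall>i\<ge>N. norm ((\<integral>x. \<bar>s (r i) x - f x\<bar> \<partial>M) - 0) < e"
      using \<open>0 < e\<close> by (intro exI[of _ N]) fastforce
  qed
  ultimately show ?thesis
    using that r(1) lim by blast
qed

section \<open>Potentials and the interaction energy of densities\<close>

locale mean_field = prob_space m
  for m :: "'a::{t2_space, second_countable_topology} measure" +
  fixes W :: "'a \<times> 'a \<Rightarrow> real" and \<gamma> :: real
  assumes sets_m [measurable_cong]: "sets m = sets borel"
    and compact_space: "compact (UNIV :: 'a set)"
    and W_cont: "continuous_on UNIV W"
    and W_sym: "\<And>x y. W (x, y) = W (y, x)"
    and gamma_pos: "0 < \<gamma>"
begin

lemma space_m [simp]: "space m = UNIV"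
  using sets_m sets_eq_imp_space_eq by fastforce

lemma prob_UNIV [simp]: "prob UNIV = 1"
  using prob_space by simp

lemma W_measurable [measurable]: "W \<in> borel_measurable (borel \<Otimes>\<^sub>M borel)"
  unfolding borel_prod using W_cont by (rule borel_measurable_continuous_onI)

definition W_bound :: real where
  "W_bound = (SUP z. \<bar>W z\<bar>)"

lemma W_le: "\<bar>W z\<bar> \<le> W_bound"
proof -
  have "compact (UNIV :: ('a \<times> 'a) set)"
    using compact_Times[OF compact_space compact_space] by simp
  then have "compact (range (\<lambda>z. \<bar>W z\<bar>))"
    using W_cont by (intro compact_continuous_image continuous_intros)
  then show ?thesis
    unfolding W_bound_def by (intro cSUP_upper) (auto simp: compact_imp_bounded bounded_imp_bdd_above)
qed

lemma W_bound_nonneg: "0 \<le> W_bound"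
  using W_le[of undefined] by linarith

definition potential :: "('a \<Rightarrow> real) \<Rightarrow> 'a \<Rightarrow> real" where
  "potential f x = (\<integral>y. W (x, y) * f y \<partial>m)"

text \<open>The symmetric bilinear form whose diagonal is twice the interaction energy.\<close>

definition pairing :: "('a \<Rightarrow> real) \<Rightarrow> ('a \<Rightarrow> real) \<Rightarrow> real" where
  "pairing f h = (\<integral>x. potential f x * h x \<partial>m)"

lemma integrable_bounded_mult:
  fixes f v :: "'a \<Rightarrow> real"
  assumes "integrable m f" "v \<in> borel_measurable m" "\<And>x. \<bar>v x\<bar> \<le> B"
  shows "integrable m (\<lambda>x. v x * f x)"
proof (rule Bochner_Integration.integrable_bound)
  show "integrable m (\<lambda>x. B * f x)"
    using assms by simp
  show "(\<lambda>x. v x * f x) \<in> borel_measurable m"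
    using assms by measurable
  have "\<bar>v x\<bar> * \<bar>f x\<bar> \<le> \<bar>B\<bar> * \<bar>f x\<bar>" for x
    using assms(3)[of x] by (intro mult_right_mono) auto
  then show "AE x in m. norm (v x * f x) \<le> norm (B * f x)"
    by (simp add: abs_mult)
qed

lemma abs_integral_mult_le:
  fixes f v :: "'a \<Rightarrow> real"
  assumes "integrable m f" "v \<in> borel_measurable m" "\<And>x. \<bar>v x\<bar> \<le> B"
  shows "\<bar>\<integral>x. v x * f x \<partial>m\<bar> \<le> B * (\<integral>x. \<bar>f x\<bar> \<partial>m)"
proof -
  have "\<bar>\<integral>x. v x * f x \<partial>m\<bar> \<le> (\<integral>x. \<bar>v x * f x\<bar> \<partial>m)"
    by (rule integral_abs_bound)
  also have "\<dots> \<le> (\<integral>x. B * \<bar>f x\<bar> \<partial>m)"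
    using assms integrable_bounded_mult[OF assms]
    by (intro integral_mono) (auto simp: abs_mult intro!: mult_right_mono integrable_norm[of m "\<lambda>x. v x * f x", simplified real_norm_def abs_mult])
  finally show ?thesis
    using assms by simp
qed

lemma integrable_potential:
  assumes "integrable m f"
  shows "integrable m (\<lambda>y. W (x, y) * f y)"
  using assms by (rule integrable_bounded_mult[where B = W_bound]) (auto simp: W_le)

lemma potential_le:
  assumes "integrable m f"
  shows "\<bar>potential f x\<bar> \<le> W_bound * (\<integral>x. \<bar>f x\<bar> \<partial>m)"
  unfolding potential_def using assms by (rule abs_integral_mult_le) (auto simp: W_le)

lemma potential_measurable [measurable (raw)]:
  assumes [measurable]: "f \<in> borel_measurable m"
  shows "potential f \<in> borel_measurable m"
proof -
  have "(\<lambda>x. \<integral>y. W (x, y) * f y \<partial>m) \<in> borel_measurable m"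
    by (rule borel_measurable_lebesgue_integral) measurable
  then show ?thesis
    unfolding potential_def[abs_def] .
qed

lemma integrable_pairing:
  assumes "integrable m f" "integrable m h"
  shows "integrable m (\<lambda>x. potential f x * h x)"
  using assms by (intro integrable_bounded_mult[OF _ _ potential_le]) auto

lemma pairing_le:
  assumes "integrable m f" "integrable m h"
  shows "\<bar>pairing f h\<bar> \<le> W_bound * (\<integral>x. \<bar>f x\<bar> \<partial>m) * (\<integral>x. \<bar>h x\<bar> \<partial>m)"
  unfolding pairing_def using assms by (intro abs_integral_mult_le potential_le) auto

lemma pairing_commute:
  assumes f: "integrable m f" and h: "integrable m h"
  shows "pairing f h = pairing h f"
proof -
  interpret P: pair_sigma_finite m m ..
  have [measurable]: "f \<in> borel_measurable m" "h \<in> borel_measurable m"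
    using f h by auto
  have "integrable (m \<Otimes>\<^sub>M m) (\<lambda>(x, y). W (x, y) * f y * h x)"
  proof (rule P.Fubini_integrable)
    show "(\<lambda>(x, y). W (x, y) * f y * h x) \<in> borel_measurable (m \<Otimes>\<^sub>M m)"
      by measurable
    have "integrable m (\<lambda>y. W (x, y) * f y * h x)" for x
      using integrable_potential[OF f] by simp
    then show "AE x in m. integrable m (\<lambda>y. case (x, y) of (x, y) \<Rightarrow> W (x, y) * f y * h x)"
      by simp
    have "integrable m (\<lambda>x. (\<integral>y. \<bar>W (x, y) * f y\<bar> \<partial>m) * \<bar>h x\<bar>)"
    proof (rule integrable_bounded_mult)
      show "\<bar>\<integral>y. \<bar>W (x, y) * f y\<bar> \<partial>m\<bar> \<le> W_bound * (\<integral>y. \<bar>f y\<bar> \<partial>m)" for x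
        using abs_integral_mult_le[of "\<lambda>y. \<bar>f y\<bar>" "\<lambda>y. \<bar>W (x, y)\<bar>" W_bound] f
        by (simp add: W_le abs_mult)
      have "(\<lambda>x. \<integral>y. \<bar>W (x, y) * f y\<bar> \<partial>m) \<in> borel_measurable m"
        by (rule borel_measurable_lebesgue_integral) measurable
      then show "random_variable borel (\<lambda>x. \<integral>y. \<bar>W (x, y) * f y\<bar> \<partial>m)" .
    qed (use h in simp)
    then show "integrable m (\<lambda>x. \<integral>y. norm (case (x, y) of (x, y) \<Rightarrow> W (x, y) * f y * h x) \<partial>m)"
      by (simp add: abs_mult)
  qed
  then have "(\<integral>y. (\<integral>x. W (x, y) * f y * h x \<partial>m) \<partial>m) = (\<integral>x. (\<integral>y. W (x, y) * f y * h x \<partial>m) \<partial>m)"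
    by (rule P.Fubini_integral)
  moreover have "(\<integral>x. W (x, y) * f y * h x \<partial>m) = potential h y * f y" for y
    unfolding potential_def by (subst W_sym) (simp add: mult.commute mult.left_commute flip: integral_mult_right_zero)
  moreover have "(\<integral>y. W (x, y) * f y * h x \<partial>m) = potential f x * h x" for x
    unfolding potential_def by (rule integral_mult_left_zero)
  ultimately show ?thesis
    unfolding pairing_def by (simp only:)
qed

lemma potential_linear:
  assumes "integrable m f" "integrable m h"
  shows "potential (\<lambda>x. a * f x + b * h x) x = a * potential f x + b * potential h x"
proof -
  have "potential (\<lambda>x. a * f x + b * h x) x
      = (\<integral>y. a * (W (x, y) * f y) + b * (W (x, y) * h y) \<partial>m)"
    unfolding potential_def by (simp add: algebra_simps)
  then show ?thesis
    using assms by (simp add: integrable_potential potential_def)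
qed

lemma pairing_linear_left:
  assumes "integrable m f" "integrable m h" "integrable m k"
  shows "pairing (\<lambda>x. a * f x + b * h x) k = a * pairing f k + b * pairing h k"
proof -
  have "pairing (\<lambda>x. a * f x + b * h x) k
      = (\<integral>x. a * (potential f x * k x) + b * (potential h x * k x) \<partial>m)"
    unfolding pairing_def using assms by (simp add: potential_linear algebra_simps)
  then show ?thesis
    using assms by (simp add: integrable_pairing pairing_def)
qed

lemma pairing_square:
  assumes "integrable m f" "integrable m h"
  shows "pairing (\<lambda>x. a * f x + b * h x) (\<lambda>x. a * f x + b * h x)
    = a\<^sup>2 * pairing f f + 2 * a * b * pairing f h + b\<^sup>2 * pairing h h"
proof -
  let ?k = "\<lambda>x. a * f x + b * h x"
  have k: "integrable m ?k"
    using assms by simp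
  have "pairing ?k ?k = a * pairing ?k f + b * pairing ?k h"
    using assms k by (simp add: pairing_linear_left pairing_commute[OF _ k])
  then show ?thesis
    using assms pairing_commute[OF assms]
    by (simp add: pairing_linear_left algebra_simps power2_eq_square)
qed

text \<open>By compactness of the second factor, a neighbourhood of \<open>{x} \<times> UNIV\<close> contains a tube, so the
  estimate is uniform in \<open>y\<close>. This modulus is shared by the potentials of all densities.\<close>

lemma kernel_equicontinuous:
  assumes "0 < e"
  shows "\<exists>U. open U \<and> x \<in> U \<and> (\<forall>x'\<in>U. \<forall>y. \<bar>W (x', y) - W (x, y)\<bar> < e)"
proof -
  let ?O = "{(x', y). \<bar>W (x', y) - W (x, y)\<bar> < e}"
  have "continuous_on UNIV (\<lambda>z. \<bar>W (fst z, snd z) - W (x, snd z)\<bar>)"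
    by (intro continuous_intros continuous_on_compose2[OF W_cont]) auto
  then have "open {z. \<bar>W (fst z, snd z) - W (x, snd z)\<bar> < e}"
    by (intro open_Collect_less) auto
  then have "open ?O"
    by (simp add: case_prod_beta')
  moreover have "{x} \<times> UNIV \<subseteq> ?O"
    using assms by auto
  ultimately have "\<exists>U. x \<in> U \<and> open U \<and> U \<times> UNIV \<subseteq> ?O"
    by (rule Elementary_Topology.tube_lemma[OF compact_space])
  then obtain U where "x \<in> U" "open U" "U \<times> UNIV \<subseteq> ?O"
    by (elim exE conjE)
  then show ?thesis
    by (intro exI[of _ U]) auto
qed

lemma potential_diff_le:
  assumes f: "integrable m f" and close: "\<And>y. \<bar>W (x', y) - W (x, y)\<bar> \<le> e"
  shows "\<bar>potential f x' - potential f x\<bar> \<le> e * (\<integral>y. \<bar>f y\<bar> \<partial>m)"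
proof -
  have "potential f x' - potential f x = (\<integral>y. (W (x', y) - W (x, y)) * f y \<partial>m)"
    unfolding potential_def using integrable_potential[OF f] by (simp add: left_diff_distrib)
  then show ?thesis
    using abs_integral_mult_le[OF f, of "\<lambda>y. W (x', y) - W (x, y)" e] close by simp
qed

text \<open>An Arzela-Ascoli argument: a diagonal subsequence of the potentials converges on a countable dense
  set, and equicontinuity with compactness makes it uniformly Cauchy.\<close>

lemma uniformly_Cauchy_potentials:
  assumes f: "\<And>n. integrable m (f n)" and norm_f: "\<And>n. (\<integral>x. \<bar>f n x\<bar> \<partial>m) \<le> 1"
  obtains k where "strict_mono (k :: nat \<Rightarrow> nat)"
    "\<And>e. 0 < e \<Longrightarrow> \<exists>N. \<forall>i\<ge>N. \<forall>j\<ge>N. \<forall>x. \<bar>potential (f (k i)) x - potential (f (k j)) x\<bar> \<le> e"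
proof -
  obtain D :: "'a set" where D: "countable D" "\<And>X. open X \<Longrightarrow> X \<noteq> {} \<Longrightarrow> \<exists>d\<in>D. d \<in> X"
    using countable_dense_exists by blast
  have "norm (potential (f n) x) \<le> W_bound" for n x
  proof -
    have "W_bound * (\<integral>x. \<bar>f n x\<bar> \<partial>m) \<le> W_bound * 1"
      using norm_f W_bound_nonneg by (intro mult_left_mono) auto
    then show ?thesis
      using potential_le[OF f, of n x] by simp
  qed
  then obtain k where k: "strict_mono (k :: nat \<Rightarrow> nat)"
    and conv: "\<And>x. x \<in> D \<Longrightarrow> \<exists>l. (\<lambda>n. potential (f (k n)) x) \<longlonglongrightarrow> l"
    using function_convergent_subsequence[OF D(1), of "\<lambda>n. potential (f n)" W_bound] by blast
  have "\<exists>N. \<forall>i\<ge>N. \<forall>j\<ge>N. \<forall>x. \<bar>potential (f (k i)) x - potential (f (k j)) x\<bar> \<le> e" if e: "0 < e" for e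
  proof -
    \<comment> \<open>Moving from \<open>x\<close> to the nearby point of \<open>D\<close> costs \<open>2 e / 5\<close> for each of the two potentials.\<close>
    have "0 < e / 5"
      using e by simp
    then have "\<exists>U. open U \<and> p \<in> U \<and> (\<forall>x'\<in>U. \<forall>y. \<bar>W (x', y) - W (p, y)\<bar> < e / 5)" for p
      by (rule kernel_equicontinuous)
    then obtain U where U: "\<And>p. open (U p)" "\<And>p. p \<in> U p"
        "\<And>p x y. x \<in> U p \<Longrightarrow> \<bar>W (x, y) - W (p, y)\<bar> < e / 5"
      by metis
    have "UNIV \<subseteq> (\<Union>p. U p)"
      using U(2) by blast
    then obtain F where F: "finite F" "UNIV \<subseteq> (\<Union>p\<in>F. U p)"
      using compactE_image[OF compact_space, of UNIV U] U(1) by metis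
    have "\<exists>d\<in>D. d \<in> U p" for p
      using U(1)[of p] U(2)[of p] by (intro D(2)) auto
    then obtain d where d: "\<And>p. d p \<in> D" "\<And>p. d p \<in> U p"
      by metis
    have "\<exists>N. \<forall>i\<ge>N. \<forall>j\<ge>N. \<bar>potential (f (k i)) (d p) - potential (f (k j)) (d p)\<bar> < e / 5" for p
    proof -
      have "Cauchy (\<lambda>n. potential (f (k n)) (d p))"
        using conv[OF d(1)[of p]] by (auto intro: LIMSEQ_imp_Cauchy)
      then show ?thesis
        using e unfolding Cauchy_def dist_real_def by (meson \<open>0 < e / 5\<close>)
    qed
    then obtain N where N: "\<And>p i j. N p \<le> i \<Longrightarrow> N p \<le> j \<Longrightarrow>
        \<bar>potential (f (k i)) (d p) - potential (f (k j)) (d p)\<bar> < e / 5"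
      by metis
    have "\<bar>potential (f (k i)) x - potential (f (k j)) x\<bar> \<le> e"
      if "Max (N ` F) \<le> i" "Max (N ` F) \<le> j" for i j x
    proof -
      obtain p where p: "p \<in> F" "x \<in> U p"
        using F by blast
      have "N p \<le> Max (N ` F)"
        using F p by simp
      then have "\<bar>potential (f (k i)) (d p) - potential (f (k j)) (d p)\<bar> < e / 5"
        using that by (intro N) auto
      moreover have "\<bar>potential (f n) x - potential (f n) (d p)\<bar> \<le> 2 * e / 5" for n
      proof -
        have "\<bar>W (x, y) - W (d p, y)\<bar> \<le> 2 * e / 5" for y
          using U(3)[OF p(2), of y] U(3)[OF d(2)[of p], of y] by linarith
        then have "\<bar>potential (f n) x - potential (f n) (d p)\<bar> \<le> 2 * e / 5 * (\<integral>y. \<bar>f n y\<bar> \<partial>m)"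
          by (rule potential_diff_le[OF f])
        also have "\<dots> \<le> 2 * e / 5 * 1"
          using norm_f e by (intro mult_left_mono) auto
        finally show ?thesis
          by simp
      qed
      from this[of "k i"] this[of "k j"] calculation show ?thesis
        by linarith
    qed
    then show ?thesis
      by blast
  qed
  then show ?thesis
    using that k by blast
qed

section \<open>The entropy of densities and the Hellinger distance\<close>

text \<open>Densities of finite entropy that may vanish on sets of positive measure. Unlike positivity,
  nonnegativity survives limits, which is why existence is proved in this larger class.\<close>

definition admissible :: "('a \<Rightarrow> real) \<Rightarrow> bool" where
  "admissible \<rho> \<longleftrightarrow> integrable m \<rho> \<and> (\<forall>x. 0 \<le> \<rho> x) \<and> (\<integral>x. \<rho> x \<partial>m) = 1 \<and>
     integrable m (\<lambda>x. \<rho> x * ln (\<rho> x))"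

definition density_entropy :: "('a \<Rightarrow> real) \<Rightarrow> real" where
  "density_entropy \<rho> = (\<integral>x. \<rho> x * ln (\<rho> x) \<partial>m)"

definition density_energy :: "('a \<Rightarrow> real) \<Rightarrow> real" where
  "density_energy \<rho> = density_entropy \<rho> / \<gamma> + pairing \<rho> \<rho> / 2"

text \<open>The square of the Hellinger distance, up to normalization.\<close>

definition hellinger :: "('a \<Rightarrow> real) \<Rightarrow> ('a \<Rightarrow> real) \<Rightarrow> real" where
  "hellinger \<rho> \<sigma> = (\<integral>x. (sqrt (\<rho> x) - sqrt (\<sigma> x))\<^sup>2 \<partial>m)"

lemma admissibleD:
  assumes "admissible \<rho>"
  shows "integrable m \<rho>" "0 \<le> \<rho> x" "(\<integral>x. \<rho> x \<partial>m) = 1" "(\<integral>x. \<bar>\<rho> x\<bar> \<partial>m) = 1"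
    "integrable m (\<lambda>x. \<rho> x * ln (\<rho> x))" "\<rho> \<in> borel_measurable m"
  using assms unfolding admissible_def by auto

lemma integrable_hellinger:
  assumes "admissible \<rho>" "admissible \<sigma>"
  shows "integrable m (\<lambda>x. (sqrt (\<rho> x) - sqrt (\<sigma> x))\<^sup>2)"
proof (rule Bochner_Integration.integrable_bound)
  note [measurable] = admissibleD(6)[OF assms(1)] admissibleD(6)[OF assms(2)]
  show "integrable m (\<lambda>x. \<rho> x + \<sigma> x)"
    using assms by (auto dest: admissibleD)
  show "(\<lambda>x. (sqrt (\<rho> x) - sqrt (\<sigma> x))\<^sup>2) \<in> borel_measurable m"
    by measurable
  have "(sqrt (\<rho> x) - sqrt (\<sigma> x))\<^sup>2 \<le> \<rho> x + \<sigma> x" for x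
    using admissibleD(2)[OF assms(1), of x] admissibleD(2)[OF assms(2), of x]
    by (simp add: power2_diff)
  then show "AE x in m. norm ((sqrt (\<rho> x) - sqrt (\<sigma> x))\<^sup>2) \<le> norm (\<rho> x + \<sigma> x)"
    using admissibleD(2)[OF assms(1)] admissibleD(2)[OF assms(2)] by (auto intro!: AE_I2)
qed

lemma admissible_mixture:
  assumes \<rho>: "admissible \<rho>" and \<sigma>: "admissible \<sigma>" and t: "0 \<le> t" "t \<le> 1"
  defines "\<tau> \<equiv> \<lambda>x. (1 - t) * \<rho> x + t * \<sigma> x"
  shows "admissible \<tau>"
    and "density_entropy \<tau> + t * (1 - t) * hellinger \<rho> \<sigma>
      \<le> (1 - t) * density_entropy \<rho> + t * density_entropy \<sigma>"
proof -
  note [measurable] = admissibleD(6)[OF \<rho>] admissibleD(6)[OF \<sigma>]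
  note D = admissibleD[OF \<rho>] admissibleD[OF \<sigma>]
  have \<tau>_nonneg: "0 \<le> \<tau> x" for x
    using t D unfolding \<tau>_def by simp
  have gap: "\<tau> x * ln (\<tau> x) + t * (1 - t) * (sqrt (\<rho> x) - sqrt (\<sigma> x))\<^sup>2
      \<le> (1 - t) * (\<rho> x * ln (\<rho> x)) + t * (\<sigma> x * ln (\<sigma> x))" for x
    unfolding \<tau>_def using D t by (intro entropy_convexity_gap) auto
  have int: "integrable m (\<lambda>x. \<tau> x * ln (\<tau> x))"
  proof (rule Bochner_Integration.integrable_bound)
    let ?b = "\<lambda>x. 1 + \<bar>(1 - t) * (\<rho> x * ln (\<rho> x)) + t * (\<sigma> x * ln (\<sigma> x))\<bar>"
    show "integrable m ?b"
      using D by simp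
    show "(\<lambda>x. \<tau> x * ln (\<tau> x)) \<in> borel_measurable m"
      unfolding \<tau>_def by measurable
    have "\<bar>\<tau> x * ln (\<tau> x)\<bar> \<le> ?b x" for x
    proof -
      have "0 \<le> t * (1 - t) * (sqrt (\<rho> x) - sqrt (\<sigma> x))\<^sup>2"
        using t by simp
      then show ?thesis
        using gap[of x] entropy_density_ge[OF \<tau>_nonneg, of x] by linarith
    qed
    then show "AE x in m. norm (\<tau> x * ln (\<tau> x)) \<le> norm (?b x)"
      by (intro AE_I2) (smt (verit) real_norm_def)
  qed
  then show "admissible \<tau>"
    using D \<tau>_nonneg unfolding admissible_def by (simp add: \<tau>_def)
  have "(\<integral>x. \<tau> x * ln (\<tau> x) + t * (1 - t) * (sqrt (\<rho> x) - sqrt (\<sigma> x))\<^sup>2 \<partial>m)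
      \<le> (\<integral>x. (1 - t) * (\<rho> x * ln (\<rho> x)) + t * (\<sigma> x * ln (\<sigma> x)) \<partial>m)"
    using int D(5) D(11) integrable_hellinger[OF \<rho> \<sigma>] by (intro integral_mono gap) simp_all
  then show "density_entropy \<tau> + t * (1 - t) * hellinger \<rho> \<sigma>
      \<le> (1 - t) * density_entropy \<rho> + t * density_entropy \<sigma>"
    using int D(5) D(11) integrable_hellinger[OF \<rho> \<sigma>] by (simp add: density_entropy_def hellinger_def)
qed

lemma hellinger_nonneg: "0 \<le> hellinger \<rho> \<sigma>"
  unfolding hellinger_def by (simp add: integral_nonneg)

text \<open>From \<open>\<bar>\<rho> - \<sigma>\<bar> = \<bar>\<surd>\<rho> - \<surd>\<sigma>\<bar> (\<surd>\<rho> + \<surd>\<sigma>)\<close> and the arithmetic-geometric mean inequality with weight \<open>c\<close>,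
  which replaces Cauchy-Schwarz; \<open>c\<close> is to be chosen of the order of the Hellinger distance.\<close>

lemma L1_le_hellinger:
  assumes \<rho>: "admissible \<rho>" and \<sigma>: "admissible \<sigma>" and c: "0 < c"
  shows "(\<integral>x. \<bar>\<rho> x - \<sigma> x\<bar> \<partial>m) \<le> hellinger \<rho> \<sigma> / c + c"
proof -
  note D = admissibleD[OF \<rho>] admissibleD[OF \<sigma>]
  note H = integrable_hellinger[OF \<rho> \<sigma>]
  have pointwise: "\<bar>\<rho> x - \<sigma> x\<bar> \<le> (sqrt (\<rho> x) - sqrt (\<sigma> x))\<^sup>2 / c + c / 2 * (\<rho> x + \<sigma> x)" for x
  proof -
    define u v where "u = sqrt (\<rho> x)" and "v = sqrt (\<sigma> x)"
    have uv: "0 \<le> u" "0 \<le> v" "\<rho> x = u\<^sup>2" "\<sigma> x = v\<^sup>2"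
      using D(2)[of x] D(8)[of x] by (auto simp: u_def v_def)
    define p q where "p = \<bar>u - v\<bar>" and "q = u + v"
    have "\<rho> x - \<sigma> x = (u - v) * q"
      unfolding uv q_def by (simp add: power2_eq_square algebra_simps)
    then have "\<bar>\<rho> x - \<sigma> x\<bar> = p * \<bar>q\<bar>"
      unfolding p_def by (simp only: abs_mult)
    then have "\<bar>\<rho> x - \<sigma> x\<bar> = p * q"
      using uv by (simp add: q_def)
    moreover have "p * q \<le> p\<^sup>2 / c + c / 4 * q\<^sup>2"
    proof -
      have "0 \<le> (p - c / 2 * q)\<^sup>2 / c"
        using c by simp
      also have "\<dots> = p\<^sup>2 / c - p * q + c / 4 * q\<^sup>2"
        using c by (simp add: power2_eq_square field_simps)
      finally show ?thesis
        by simp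
    qed
    moreover have "q\<^sup>2 \<le> 2 * (\<rho> x + \<sigma> x)"
      using zero_le_power2[of "u - v"] unfolding uv q_def by (simp add: power2_eq_square algebra_simps)
    then have "c / 4 * q\<^sup>2 \<le> c / 4 * (2 * (\<rho> x + \<sigma> x))"
      using c by (intro mult_left_mono) auto
    then have "c / 4 * q\<^sup>2 \<le> c / 2 * (\<rho> x + \<sigma> x)"
      by (simp add: algebra_simps)
    moreover have "p\<^sup>2 = (u - v)\<^sup>2"
      by (simp add: p_def)
    ultimately show ?thesis
      unfolding u_def[symmetric] v_def[symmetric] by simp
  qed
  have "(\<integral>x. \<bar>\<rho> x - \<sigma> x\<bar> \<partial>m) \<le> (\<integral>x. (sqrt (\<rho> x) - sqrt (\<sigma> x))\<^sup>2 / c + c / 2 * (\<rho> x + \<sigma> x) \<partial>m)"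
    using D(1) D(7) H by (intro integral_mono pointwise) simp_all
  also have "\<dots> = hellinger \<rho> \<sigma> / c + c"
    using D(1) D(7) H D(3) D(9) by (simp add: hellinger_def)
  finally show ?thesis .
qed

section \<open>Existence of a minimizing density\<close>

lemma density_energy_ge:
  assumes "admissible \<rho>"
  shows "- 1 / \<gamma> - W_bound / 2 \<le> density_energy \<rho>"
proof -
  note D = admissibleD[OF assms]
  have "(\<integral>x. -1 \<partial>m) \<le> density_entropy \<rho>"
    unfolding density_entropy_def using D(5) entropy_density_ge[OF D(2)] by (intro integral_mono) simp_all
  then have "- 1 / \<gamma> \<le> density_entropy \<rho> / \<gamma>"
    using gamma_pos by (intro divide_right_mono) simp_all
  moreover have "\<bar>pairing \<rho> \<rho>\<bar> \<le> W_bound"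
    using pairing_le[OF D(1) D(1)] D(4) by simp
  ultimately show ?thesis
    unfolding density_energy_def by linarith
qed

text \<open>The entropy gains a Hellinger term at the midpoint. The interaction exceeds its mean by at most \<open>e / 4\<close>: its defect is
  an eighth of the pairing of \<open>\<rho> - \<sigma>\<close> with itself, which integrates the potential difference, of size at
  most \<open>e\<close>, against a function of \<open>L\<^sub>1\<close> norm at most \<open>2\<close>.\<close>

lemma midpoint_energy:
  assumes \<rho>: "admissible \<rho>" and \<sigma>: "admissible \<sigma>"
    and close: "\<And>x. \<bar>potential \<rho> x - potential \<sigma> x\<bar> \<le> e"
  shows "\<exists>\<tau>. admissible \<tau> \<and>
    density_energy \<tau> + hellinger \<rho> \<sigma> / (4 * \<gamma>) \<le> density_energy \<rho> / 2 + density_energy \<sigma> / 2 + e / 4"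
proof -
  note D = admissibleD[OF \<rho>] admissibleD[OF \<sigma>]
  define \<tau> where "\<tau> = (\<lambda>x. (1 - 1 / 2) * \<rho> x + 1 / 2 * \<sigma> x)"
  have \<tau>: "admissible \<tau>" "density_entropy \<tau> + 1 / 2 * (1 - 1 / 2) * hellinger \<rho> \<sigma>
      \<le> (1 - 1 / 2) * density_entropy \<rho> + 1 / 2 * density_entropy \<sigma>"
    unfolding \<tau>_def using admissible_mixture[OF \<rho> \<sigma>, of "1 / 2"] by simp_all
  have "(density_entropy \<tau> + 1 / 4 * hellinger \<rho> \<sigma>) / \<gamma>
      \<le> (1 / 2 * density_entropy \<rho> + 1 / 2 * density_entropy \<sigma>) / \<gamma>"
    using \<tau>(2) gamma_pos by (intro divide_right_mono) simp_all
  then have entropy: "density_entropy \<tau> / \<gamma> + hellinger \<rho> \<sigma> / (4 * \<gamma>)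
      \<le> density_entropy \<rho> / \<gamma> / 2 + density_entropy \<sigma> / \<gamma> / 2"
    by (simp add: add_divide_distrib)
  have \<tau>\<tau>: "pairing \<tau> \<tau> = 1 / 4 * pairing \<rho> \<rho> + 1 / 2 * pairing \<rho> \<sigma> + 1 / 4 * pairing \<sigma> \<sigma>"
    unfolding \<tau>_def using D(1) D(7) by (subst pairing_square) (simp_all add: power2_eq_square)
  let ?d = "\<lambda>x. 1 * \<rho> x + (- 1) * \<sigma> x"
  have d: "integrable m ?d"
    using D(1) D(7) by simp
  have "(\<integral>x. \<bar>?d x\<bar> \<partial>m) \<le> (\<integral>x. \<bar>\<rho> x\<bar> + \<bar>\<sigma> x\<bar> \<partial>m)"
    using D(1) D(7) by (intro integral_mono) simp_all
  also have "\<dots> = 2"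
    using D(1) D(7) D(4) D(10) by simp
  finally have "e * (\<integral>x. \<bar>?d x\<bar> \<partial>m) \<le> e * 2"
    using close[of undefined] by (intro mult_left_mono) auto
  moreover have "\<bar>pairing ?d ?d\<bar> \<le> e * (\<integral>x. \<bar>?d x\<bar> \<partial>m)"
    unfolding pairing_def using d D(1) D(7) close
    by (intro abs_integral_mult_le) (simp_all only: potential_linear, simp_all)
  moreover have "pairing ?d ?d = pairing \<rho> \<rho> - 2 * pairing \<rho> \<sigma> + pairing \<sigma> \<sigma>"
    using D(1) D(7) by (subst pairing_square) simp_all
  ultimately have "pairing \<rho> \<rho> - 2 * pairing \<rho> \<sigma> + pairing \<sigma> \<sigma> \<ge> - (e * 2)"
    by linarith
  then show ?thesis
    using \<tau>(1) entropy \<tau>\<tau> unfolding density_energy_def add_divide_distrib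
    by (intro exI[of _ \<tau>] conjI) linarith+
qed

lemma pairing_L1_continuous:
  assumes f: "integrable m f" "(\<integral>x. \<bar>f x\<bar> \<partial>m) = 1" and h: "integrable m h" "(\<integral>x. \<bar>h x\<bar> \<partial>m) = 1"
  shows "\<bar>pairing f f - pairing h h\<bar> \<le> 2 * W_bound * (\<integral>x. \<bar>f x - h x\<bar> \<partial>m)"
proof -
  let ?d = "\<lambda>x. 1 * f x + (- 1) * h x"
  have d: "integrable m ?d"
    using f h by simp
  have "pairing f f - pairing h h = pairing ?d f + pairing ?d h"
    using pairing_linear_left[OF f(1) h(1) f(1), of 1 "-1"]
      pairing_linear_left[OF f(1) h(1) h(1), of 1 "-1"] pairing_commute[OF f(1) h(1)] by linarith
  moreover have "\<bar>pairing ?d f\<bar> \<le> W_bound * (\<integral>x. \<bar>?d x\<bar> \<partial>m) * 1"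
    using pairing_le[OF d f(1)] f(2) by simp
  moreover have "\<bar>pairing ?d h\<bar> \<le> W_bound * (\<integral>x. \<bar>?d x\<bar> \<partial>m) * 1"
    using pairing_le[OF d h(1)] h(2) by simp
  ultimately show ?thesis
    by simp
qed

definition minimizing_density :: "('a \<Rightarrow> real) \<Rightarrow> bool" where
  "minimizing_density \<rho> \<longleftrightarrow> admissible \<rho> \<and> (\<forall>\<sigma>. admissible \<sigma> \<longrightarrow> density_energy \<rho> \<le> density_energy \<sigma>)"

text \<open>A minimizing sequence with uniformly Cauchy potentials is Cauchy in Hellinger distance, because the
  energies of midpoints cannot fall below the infimum. Its \<open>L\<^sub>1\<close> limit is the minimizer.\<close>

lemma minimizing_density_exists: "\<exists>\<rho>. minimizing_density \<rho>"
proof -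
  define J where "J = (INF \<rho>\<in>Collect admissible. density_energy \<rho>)"
  have "admissible (\<lambda>_. 1)"
    unfolding admissible_def by simp
  then have ne: "Collect admissible \<noteq> {}"
    by blast
  have bdd: "bdd_below (density_energy ` Collect admissible)"
    using density_energy_ge by (intro bdd_belowI2) auto
  have J_le: "J \<le> density_energy \<rho>" if "admissible \<rho>" for \<rho>
    unfolding J_def using that by (intro cINF_lower[OF bdd]) simp
  have "\<exists>\<rho>. admissible \<rho> \<and> density_energy \<rho> < J + 1 / (real n + 1)" for n
    using cINF_less_iff[OF ne bdd, of "J + 1 / (real n + 1)"] unfolding J_def by auto
  then obtain f where f: "\<And>n. admissible (f n)" "\<And>n. density_energy (f n) < J + 1 / (real n + 1)"
    by metis
  obtain k where k: "strict_mono (k :: nat \<Rightarrow> nat)"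
    "\<And>e. 0 < e \<Longrightarrow> \<exists>N. \<forall>i\<ge>N. \<forall>j\<ge>N. \<forall>x. \<bar>potential (f (k i)) x - potential (f (k j)) x\<bar> \<le> e"
    using uniformly_Cauchy_potentials[of f] admissibleD(1,4)[OF f(1)] by (metis order_refl)
  define s where "s = (\<lambda>n. f (k n))"
  have s: "admissible (s n)" for n
    unfolding s_def by (rule f)
  have s_energy: "(\<lambda>n. density_energy (s n)) \<longlonglongrightarrow> J"
  proof (rule tendsto_sandwich[OF _ _ tendsto_const])
    show "(\<lambda>n. J + 1 / (real (k n) + 1)) \<longlonglongrightarrow> J"
    proof -
      have "(\<lambda>n. J + 1 / (real n + 1)) \<longlonglongrightarrow> J"
        by real_asymp
      from LIMSEQ_subseq_LIMSEQ[OF this k(1)] show ?thesis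
        by (simp add: o_def)
    qed
  qed (use J_le[OF s] f(2) in \<open>auto simp: s_def intro!: always_eventually less_imp_le\<close>)
  have hellinger_small: "\<exists>N. \<forall>i\<ge>N. \<forall>j\<ge>N. hellinger (s i) (s j) < e" if e: "0 < e" for e
  proof -
    \<comment> \<open>Energies within \<open>\<delta>\<close> of \<open>J\<close> and potentials within \<open>\<delta>\<close> bound the Hellinger term by \<open>4 \<gamma> \<cdot> 5 \<delta> / 4 < e\<close>.\<close>
    define \<delta> where "\<delta> = e / (8 * \<gamma>)"
    have \<delta>: "0 < \<delta>"
      using e gamma_pos by (simp add: \<delta>_def)
    obtain N1 where N1: "\<And>i j x. N1 \<le> i \<Longrightarrow> N1 \<le> j \<Longrightarrow> \<bar>potential (s i) x - potential (s j) x\<bar> \<le> \<delta>"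
      using k(2)[OF \<delta>] unfolding s_def by metis
    obtain N2 where N2: "\<And>i. N2 \<le> i \<Longrightarrow> density_energy (s i) < J + \<delta>"
      using order_tendstoD(2)[OF s_energy, of "J + \<delta>"] \<delta> unfolding eventually_sequentially by auto
    have "hellinger (s i) (s j) < e" if "max N1 N2 \<le> i" "max N1 N2 \<le> j" for i j
    proof -
      have "\<bar>potential (s i) x - potential (s j) x\<bar> \<le> \<delta>" for x
        using N1 that by simp
      then obtain \<tau> where \<tau>: "admissible \<tau>" "density_energy \<tau> + hellinger (s i) (s j) / (4 * \<gamma>)
          \<le> density_energy (s i) / 2 + density_energy (s j) / 2 + \<delta> / 4"
        using midpoint_energy[OF s s] by blast
      have "hellinger (s i) (s j) / (4 * \<gamma>) < 2 * \<delta>"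
        using J_le[OF \<tau>(1)] \<tau>(2) N2[of i] N2[of j] that \<delta> by simp
      then show ?thesis
        using gamma_pos by (simp add: \<delta>_def field_simps)
    qed
    then show ?thesis
      by blast
  qed
  have L1_Cauchy: "\<exists>N. \<forall>i\<ge>N. \<forall>j\<ge>N. (\<integral>x. \<bar>s i x - s j x\<bar> \<partial>m) < e" if e: "0 < e" for e
  proof -
    \<comment> \<open>A Hellinger term below \<open>e\<^sup>2 / 4\<close> and the weight \<open>c = e / 2\<close> give an \<open>L\<^sub>1\<close> distance below \<open>e\<close>.\<close>
    have "0 < e * e / 4" "0 < e / 2"
      using e by simp_all
    then obtain N where N: "\<And>i j. N \<le> i \<Longrightarrow> N \<le> j \<Longrightarrow> hellinger (s i) (s j) < e * e / 4"
      using hellinger_small by metis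
    have "(\<integral>x. \<bar>s i x - s j x\<bar> \<partial>m) < e" if "N \<le> i" "N \<le> j" for i j
    proof -
      have "hellinger (s i) (s j) / (e / 2) < e / 2"
        using N[OF that] e by (simp add: field_simps)
      then show ?thesis
        using L1_le_hellinger[OF s s \<open>0 < e / 2\<close>, of i j] by linarith
    qed
    then show ?thesis
      by blast
  qed
  obtain r \<rho>' where r: "strict_mono (r :: nat \<Rightarrow> nat)" "integrable m \<rho>'"
    "AE x in m. (\<lambda>i. s (r i) x) \<longlonglongrightarrow> \<rho>' x" "(\<lambda>i. \<integral>x. \<bar>s (r i) x - \<rho>' x\<bar> \<partial>m) \<longlonglongrightarrow> 0"
    by (rule L1_Cauchy_limit[OF admissibleD(1)[OF s] L1_Cauchy])
  \<comment> \<open>The limit is nonnegative only almost everywhere; admissible densities are so everywhere.\<close>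
  define \<rho> where "\<rho> = (\<lambda>x. max 0 (\<rho>' x))"
  have \<rho>_int: "integrable m \<rho>"
    unfolding \<rho>_def using r(2) by simp
  then have \<rho>_meas [measurable]: "\<rho> \<in> borel_measurable m"
    by simp
  have "AE x in m. \<rho> x = \<rho>' x"
    using r(3)
  proof eventually_elim
    case (elim x)
    then have "0 \<le> \<rho>' x"
      by (rule LIMSEQ_le_const) (use admissibleD(2)[OF s] in auto)
    then show ?case
      by (simp add: \<rho>_def)
  qed
  then have lim: "AE x in m. (\<lambda>i. s (r i) x) \<longlonglongrightarrow> \<rho> x"
    and L1_eq: "(\<integral>x. \<bar>s (r i) x - \<rho> x\<bar> \<partial>m) = (\<integral>x. \<bar>s (r i) x - \<rho>' x\<bar> \<partial>m)" for i
    using r(3) \<rho>_int r(2) admissibleD(1)[OF s]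
    by (auto intro!: integral_cong_AE)
  have L1: "(\<lambda>i. \<integral>x. \<bar>s (r i) x - \<rho> x\<bar> \<partial>m) \<longlonglongrightarrow> 0"
    unfolding L1_eq by (rule r(4))
  have mass: "(\<integral>x. \<rho> x \<partial>m) = 1"
  proof -
    have "\<bar>1 - (\<integral>x. \<rho> x \<partial>m)\<bar> \<le> (\<integral>x. \<bar>s (r i) x - \<rho> x\<bar> \<partial>m)" for i
    proof -
      have "1 - (\<integral>x. \<rho> x \<partial>m) = (\<integral>x. s (r i) x - \<rho> x \<partial>m)"
        using admissibleD(1,3)[OF s] \<rho>_int by simp
      then show ?thesis
        by (metis integral_abs_bound)
    qed
    then have "\<bar>1 - (\<integral>x. \<rho> x \<partial>m)\<bar> \<le> 0"
      by (intro LIMSEQ_le_const[OF L1]) auto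
    then show ?thesis
      by simp
  qed
  have entropy_lim: "AE x in m. (\<lambda>i. s (r i) x * ln (s (r i) x)) \<longlonglongrightarrow> \<rho> x * ln (\<rho> x)"
    using lim
  proof eventually_elim
    case (elim x)
    show ?case
      by (rule continuous_on_tendsto_compose[OF continuous_on_entropy_density elim])
        (use admissibleD(2)[OF s] in \<open>auto simp: \<rho>_def\<close>)
  qed
  have \<rho>_nonneg: "0 \<le> \<rho> x" for x
    by (simp add: \<rho>_def)
  then have \<rho>_norm: "(\<integral>x. \<bar>\<rho> x\<bar> \<partial>m) = 1"
    using mass by simp
  have pairing_lim: "(\<lambda>i. pairing (s (r i)) (s (r i))) \<longlonglongrightarrow> pairing \<rho> \<rho>"
  proof (rule LIM_zero_cancel, rule Lim_null_comparison[OF always_eventually])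
    show "\<forall>i. norm (pairing (s (r i)) (s (r i)) - pairing \<rho> \<rho>)
        \<le> 2 * W_bound * (\<integral>x. \<bar>s (r i) x - \<rho> x\<bar> \<partial>m)"
      using pairing_L1_continuous[OF admissibleD(1)[OF s] admissibleD(4)[OF s] \<rho>_int \<rho>_norm] by simp
    show "(\<lambda>i. 2 * W_bound * (\<integral>x. \<bar>s (r i) x - \<rho> x\<bar> \<partial>m)) \<longlonglongrightarrow> 0"
      using tendsto_mult_right_zero[OF L1] by blast
  qed
  \<comment> \<open>Energy and interaction both converge, hence so does the entropy; Fatou needs its limit.\<close>
  have "(\<lambda>i. \<gamma> * (density_energy (s (r i)) - pairing (s (r i)) (s (r i)) / 2))
      \<longlonglongrightarrow> \<gamma> * (J - pairing \<rho> \<rho> / 2)"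
    using LIMSEQ_subseq_LIMSEQ[OF s_energy r(1)] unfolding o_def by (intro tendsto_intros pairing_lim) auto
  moreover have "\<gamma> * (density_energy (s (r i)) - pairing (s (r i)) (s (r i)) / 2)
      = (\<integral>x. s (r i) x * ln (s (r i) x) \<partial>m)" for i
    using gamma_pos by (simp add: density_energy_def density_entropy_def)
  ultimately have "(\<lambda>i. \<integral>x. s (r i) x * ln (s (r i) x) \<partial>m) \<longlonglongrightarrow> \<gamma> * (J - pairing \<rho> \<rho> / 2)"
    by simp
  note fatou = fatou_bounded_below[OF admissibleD(5)[OF s] entropy_density_ge[OF admissibleD(2)[OF s]]
      entropy_lim _ this]
  have \<rho>_adm: "admissible \<rho>"
    unfolding admissible_def using \<rho>_int \<rho>_nonneg mass fatou(1) by simp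
  have "density_entropy \<rho> \<le> \<gamma> * (J - pairing \<rho> \<rho> / 2)"
    unfolding density_entropy_def by (rule fatou(2)) simp
  then have "density_energy \<rho> \<le> J"
    using gamma_pos unfolding density_energy_def by (simp add: field_simps)
  then show ?thesis
    using \<rho>_adm J_le unfolding minimizing_density_def by (intro exI[of _ \<rho>]) force
qed

section \<open>Minimizing densities are Gibbs densities\<close>

text \<open>The normalizing constant of the Gibbs density of the potential that \<open>\<rho>\<close> itself generates. Equality of
  \<open>\<rho>\<close> with this Gibbs density is the Euler-Lagrange equation of the free energy.\<close>

definition partition_function :: "('a \<Rightarrow> real) \<Rightarrow> real" where
  "partition_function \<rho> = (\<integral>x. exp (- \<gamma> * potential \<rho> x) \<partial>m)"

definition gibbs_density :: "('a \<Rightarrow> real) \<Rightarrow> 'a \<Rightarrow> real" where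
  "gibbs_density \<rho> x = exp (- \<gamma> * potential \<rho> x) / partition_function \<rho>"

context
  fixes \<rho> :: "'a \<Rightarrow> real"
  assumes \<rho>: "admissible \<rho>"
begin

lemma weight_bounds:
  "exp (- \<gamma> * potential \<rho> x) \<le> exp (\<gamma> * W_bound)" "exp (- \<gamma> * W_bound) \<le> exp (- \<gamma> * potential \<rho> x)"
proof -
  have "\<bar>potential \<rho> x\<bar> \<le> W_bound"
    using potential_le[OF admissibleD(1)[OF \<rho>], of x] admissibleD(4)[OF \<rho>] by simp
  then have "\<gamma> * - potential \<rho> x \<le> \<gamma> * W_bound" "\<gamma> * potential \<rho> x \<le> \<gamma> * W_bound"
    using gamma_pos by (intro mult_left_mono; simp)+
  then show "exp (- \<gamma> * potential \<rho> x) \<le> exp (\<gamma> * W_bound)"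
    "exp (- \<gamma> * W_bound) \<le> exp (- \<gamma> * potential \<rho> x)"
    by simp_all
qed

lemma integrable_weight: "integrable m (\<lambda>x. exp (- \<gamma> * potential \<rho> x))"
proof (rule integrable_const_bound)
  note [measurable] = admissibleD(6)[OF \<rho>]
  show "(\<lambda>x. exp (- \<gamma> * potential \<rho> x)) \<in> borel_measurable m"
    by measurable
  show "AE x in m. norm (exp (- \<gamma> * potential \<rho> x)) \<le> exp (\<gamma> * W_bound)"
    using weight_bounds(1) by simp
qed

lemma partition_function_ge: "exp (- \<gamma> * W_bound) \<le> partition_function \<rho>"
proof -
  have "(\<integral>x. exp (- \<gamma> * W_bound) \<partial>m) \<le> partition_function \<rho>"
    unfolding partition_function_def using weight_bounds(2) integrable_weight by (intro integral_mono) simp_all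
  then show ?thesis
    by simp
qed

lemma partition_function_pos: "0 < partition_function \<rho>"
  using partition_function_ge by (rule less_le_trans[OF exp_gt_zero])

lemma gibbs_density_pos: "0 < gibbs_density \<rho> x"
  unfolding gibbs_density_def using partition_function_pos by simp

lemma gibbs_density_le: "gibbs_density \<rho> x \<le> exp (\<gamma> * W_bound) / exp (- \<gamma> * W_bound)"
  unfolding gibbs_density_def using weight_bounds(1) partition_function_ge
  by (intro frac_le) simp_all

lemma ln_gibbs_density:
  "ln (gibbs_density \<rho> x) = - \<gamma> * potential \<rho> x - ln (partition_function \<rho>)"
  unfolding gibbs_density_def using partition_function_pos by (simp add: ln_div)

lemma admissible_gibbs_density: "admissible (gibbs_density \<rho>)"
proof -
  note D = admissibleD[OF \<rho>]
  note [measurable] = D(6)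
  have int: "integrable m (gibbs_density \<rho>)"
    unfolding gibbs_density_def[abs_def] using integrable_weight by simp
  have "(\<integral>x. gibbs_density \<rho> x \<partial>m) = 1"
    unfolding gibbs_density_def using integrable_weight partition_function_pos
    by (simp add: partition_function_def)
  moreover have "integrable m (\<lambda>x. - \<gamma> * (potential \<rho> x * gibbs_density \<rho> x)
      - ln (partition_function \<rho>) * gibbs_density \<rho> x)"
    using int integrable_pairing[OF D(1) int] by simp
  then have "integrable m (\<lambda>x. gibbs_density \<rho> x * ln (gibbs_density \<rho> x))"
    unfolding ln_gibbs_density by (simp add: algebra_simps)
  ultimately show ?thesis
    using int gibbs_density_pos unfolding admissible_def by (auto intro: less_imp_le)
qed

text \<open>The logarithm of the Gibbs density is affine in the potential, so the tangent bound for the entropy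
  integrand, taken at the Gibbs density, integrates exactly to the linearized functional. The
  constants drop out because both densities have mass \<open>1\<close>.\<close>

lemma gibbs_variational_gap:
  assumes \<tau>: "admissible \<tau>"
  shows "density_entropy (gibbs_density \<rho>) + \<gamma> * pairing \<rho> (gibbs_density \<rho>)
      + hellinger \<tau> (gibbs_density \<rho>) \<le> density_entropy \<tau> + \<gamma> * pairing \<rho> \<tau>"
proof -
  let ?\<sigma> = "gibbs_density \<rho>"
  let ?V = "potential \<rho>"
  define c where "c = 1 - ln (partition_function \<rho>)"
  note D = admissibleD[OF \<rho>] and T = admissibleD[OF \<tau>] and S = admissibleD[OF admissible_gibbs_density]
  note int = T(1) T(5) S(1) S(5) integrable_hellinger[OF \<tau> admissible_gibbs_density]
    integrable_pairing[OF D(1) T(1)] integrable_pairing[OF D(1) S(1)]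
  have pointwise: "?\<sigma> x * ln (?\<sigma> x) + c * (\<tau> x - ?\<sigma> x) - \<gamma> * (?V x * \<tau> x) + \<gamma> * (?V x * ?\<sigma> x)
      + (sqrt (\<tau> x) - sqrt (?\<sigma> x))\<^sup>2 \<le> \<tau> x * ln (\<tau> x)" for x
  proof -
    have "(ln (?\<sigma> x) + 1) * (\<tau> x - ?\<sigma> x)
        = c * (\<tau> x - ?\<sigma> x) - \<gamma> * (?V x * \<tau> x) + \<gamma> * (?V x * ?\<sigma> x)"
      unfolding ln_gibbs_density c_def by (simp add: algebra_simps)
    then show ?thesis
      using entropy_tangent_gap[OF T(2) gibbs_density_pos, of x x] by linarith
  qed
  have "(\<integral>x. ?\<sigma> x * ln (?\<sigma> x) + c * (\<tau> x - ?\<sigma> x) - \<gamma> * (?V x * \<tau> x) + \<gamma> * (?V x * ?\<sigma> x)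
      + (sqrt (\<tau> x) - sqrt (?\<sigma> x))\<^sup>2 \<partial>m) \<le> (\<integral>x. \<tau> x * ln (\<tau> x) \<partial>m)"
    using int by (intro integral_mono pointwise) simp_all
  then show ?thesis
    using int T(3) S(3) by (simp add: density_entropy_def hellinger_def pairing_def)
qed

end

text \<open>Along the segment from \<open>\<rho>\<close> to its Gibbs density \<open>\<sigma>\<close> the entropy is convex and the interaction is a
  quadratic polynomial in \<open>t\<close>. To first order the energy therefore decreases by at least \<open>t / \<gamma>\<close> times the
  Hellinger term, and minimality bounds that term by a multiple of \<open>t\<close>.\<close>

lemma minimizing_density_eq_gibbs:
  assumes min: "minimizing_density \<rho>"
  shows "AE x in m. \<rho> x = gibbs_density \<rho> x"
proof -
  define \<sigma> where "\<sigma> = gibbs_density \<rho>"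
  have \<rho>: "admissible \<rho>"
    using min unfolding minimizing_density_def by blast
  have \<sigma>: "admissible \<sigma>"
    unfolding \<sigma>_def by (rule admissible_gibbs_density[OF \<rho>])
  note R = admissibleD[OF \<rho>] and S = admissibleD[OF \<sigma>]
  define K where "K = pairing \<rho> \<rho> - 2 * pairing \<rho> \<sigma> + pairing \<sigma> \<sigma>"
  define H where "H = hellinger \<rho> \<sigma>"
  have "H \<le> t * (\<gamma> * K / 2)" if t: "0 < t" "t \<le> 1" for t
  proof -
    define \<tau> where "\<tau> = (\<lambda>x. (1 - t) * \<rho> x + t * \<sigma> x)"
    note mix = admissible_mixture[OF \<rho> \<sigma>, of t, folded \<tau>_def]
    have \<tau>: "admissible \<tau>"
      using mix(1) t by simp
    have "0 \<le> t * (1 - t) * H"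
      using t hellinger_nonneg by (simp add: H_def)
    then have entropy: "density_entropy \<tau> \<le> (1 - t) * density_entropy \<rho> + t * density_entropy \<sigma>"
      using mix(2) t by (simp add: H_def)
    have gap: "t * (density_entropy \<sigma> + \<gamma> * pairing \<rho> \<sigma> + H) \<le> t * (density_entropy \<rho> + \<gamma> * pairing \<rho> \<rho>)"
      unfolding H_def \<sigma>_def using gibbs_variational_gap[OF \<rho> \<rho>] t by (intro mult_left_mono) simp_all
    have "pairing \<tau> \<tau> = (1 - t)\<^sup>2 * pairing \<rho> \<rho> + 2 * (1 - t) * t * pairing \<rho> \<sigma> + t\<^sup>2 * pairing \<sigma> \<sigma>"
      unfolding \<tau>_def by (rule pairing_square[OF R(1) S(1)])
    then have pairing: "pairing \<tau> \<tau> = pairing \<rho> \<rho> + 2 * t * (pairing \<rho> \<sigma> - pairing \<rho> \<rho>) + t\<^sup>2 * K"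
      by (simp add: K_def power2_eq_square algebra_simps)
    have "\<gamma> * density_energy \<rho> \<le> \<gamma> * density_energy \<tau>"
      using min \<tau> gamma_pos unfolding minimizing_density_def by simp
    then have "density_entropy \<rho> + \<gamma> / 2 * pairing \<rho> \<rho> \<le> density_entropy \<tau> + \<gamma> / 2 * pairing \<tau> \<tau>"
      using gamma_pos unfolding density_energy_def by (simp add: algebra_simps)
    then have "t * H \<le> \<gamma> / 2 * (t\<^sup>2 * K)"
      using entropy gap unfolding pairing by (simp add: algebra_simps)
    then have "t * H \<le> t * (t * (\<gamma> * K / 2))"
      by (simp add: power2_eq_square algebra_simps)
    then show ?thesis
      using t by simp
  qed
  moreover have "((\<lambda>t. t * (\<gamma> * K / 2)) \<longlongrightarrow> 0 * (\<gamma> * K / 2)) (at_right 0)"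
    by (intro tendsto_intros)
  ultimately have "H \<le> 0 * (\<gamma> * K / 2)"
    by (intro tendsto_lowerbound[where F = "at_right 0"])
      (auto simp: eventually_at_right_field intro!: exI[of _ 1])
  then have "(\<integral>x. (sqrt (\<rho> x) - sqrt (\<sigma> x))\<^sup>2 \<partial>m) = 0"
    using hellinger_nonneg[of \<rho> \<sigma>] unfolding H_def hellinger_def by linarith
  then have "AE x in m. (sqrt (\<rho> x) - sqrt (\<sigma> x))\<^sup>2 = 0"
    using integral_nonneg_eq_0_iff_AE[OF integrable_hellinger[OF \<rho> \<sigma>]] by simp
  then show ?thesis
    by (simp add: \<sigma>_def)
qed

lemma minimizing_density_pos:
  assumes "minimizing_density \<rho>"
  shows "AE x in m. 0 < \<rho> x"
proof -
  have "admissible \<rho>"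
    using assms unfolding minimizing_density_def by blast
  with minimizing_density_eq_gibbs[OF assms] show ?thesis
    by (auto simp: gibbs_density_pos)
qed

lemma minimizing_density_square_integrable:
  assumes "minimizing_density \<rho>"
  shows "integrable m (\<lambda>x. (\<rho> x)\<^sup>2)"
proof -
  have \<rho>: "admissible \<rho>"
    using assms unfolding minimizing_density_def by blast
  note [measurable] = admissibleD(6)[OF \<rho>]
  let ?B = "exp (\<gamma> * W_bound) / exp (- \<gamma> * W_bound)"
  have "AE x in m. \<bar>(\<rho> x)\<^sup>2\<bar> \<le> ?B\<^sup>2"
    using minimizing_density_eq_gibbs[OF assms]
  proof eventually_elim
    case (elim x)
    then have "0 \<le> \<rho> x" "\<rho> x \<le> ?B"
      using gibbs_density_pos[OF \<rho>, of x] gibbs_density_le[OF \<rho>, of x] by linarith+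
    then show ?case
      using power_mono[of "\<rho> x" ?B 2] by simp
  qed
  then show ?thesis
    by (intro integrable_const_bound[where B = "?B\<^sup>2"]) simp_all
qed

section \<open>From densities to probability measures\<close>

lemma prob_measures_density:
  assumes "admissible \<rho>"
  shows "density m (\<lambda>x. ennreal (\<rho> x)) \<in> prob_measures"
proof -
  note D = admissibleD[OF assms]
  have "(\<integral>\<^sup>+x. ennreal (\<rho> x) \<partial>m) = 1"
    using nn_integral_eq_integral[OF D(1)] D(2,3) by simp
  then have "prob_space (density m (\<lambda>x. ennreal (\<rho> x)))"
    using D(6) by (intro prob_spaceI) (simp add: emeasure_density)
  then show ?thesis
    unfolding prob_measures_def using sets_m by simp
qed

lemma interaction_energy_density:
  assumes "admissible \<rho>"
  shows "interaction_energy W (density m (\<lambda>x. ennreal (\<rho> x))) = pairing \<rho> \<rho> / 2"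
proof -
  note D = admissibleD[OF assms]
  let ?\<mu> = "density m (\<lambda>x. ennreal (\<rho> x))"
  have prob: "prob_space ?\<mu>"
    using prob_measures_density[OF assms] unfolding prob_measures_def by simp
  then interpret P: pair_prob_space ?\<mu> ?\<mu>
    unfolding pair_prob_space_def pair_sigma_finite_def by (simp add: prob_space_imp_sigma_finite)
  have [measurable_cong]: "sets ?\<mu> = sets borel"
    using sets_m by simp
  have [measurable]: "\<rho> \<in> borel_measurable m"
    by (rule D(6))
  have "integrable (?\<mu> \<Otimes>\<^sub>M ?\<mu>) W"
    by (rule P.integrable_const_bound[where B = W_bound]) (simp_all add: W_le)
  then have "(\<integral>z. W z \<partial>(?\<mu> \<Otimes>\<^sub>M ?\<mu>)) = (\<integral>x. (\<integral>y. W (x, y) \<partial>?\<mu>) \<partial>?\<mu>)"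
    by (rule P.integral_fst'[symmetric])
  also have "\<dots> = (\<integral>x. potential \<rho> x \<partial>?\<mu>)"
  proof (intro Bochner_Integration.integral_cong refl)
    fix x
    have "(\<integral>y. W (x, y) \<partial>?\<mu>) = (\<integral>y. \<rho> y *\<^sub>R W (x, y) \<partial>m)"
      using D(2) by (intro integral_density) auto
    then show "(\<integral>y. W (x, y) \<partial>?\<mu>) = potential \<rho> x"
      by (simp add: potential_def mult.commute)
  qed
  also have "\<dots> = (\<integral>x. \<rho> x *\<^sub>R potential \<rho> x \<partial>m)"
    using D(2) by (intro integral_density) auto
  finally show ?thesis
    by (simp add: interaction_energy_def pairing_def mult.commute)
qed

lemma ennreal_max_0: "ennreal (max 0 x) = ennreal x"
  by (simp add: max_def ennreal_neg)

lemma extended_integral_eq_integral: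
  assumes "integrable m f"
  shows "extended_integral m f = ereal (\<integral>x. f x \<partial>m)"
proof -
  have "(\<integral>\<^sup>+x. ennreal (f x) \<partial>m) = ennreal (\<integral>x. max 0 (f x) \<partial>m)"
    "(\<integral>\<^sup>+x. ennreal (- f x) \<partial>m) = ennreal (\<integral>x. max 0 (- f x) \<partial>m)"
    using assms by (subst nn_integral_eq_integral[symmetric]; simp add: ennreal_max_0)+
  moreover have "(\<integral>x. f x \<partial>m) = (\<integral>x. max 0 (f x) - max 0 (- f x) \<partial>m)"
    by (intro Bochner_Integration.integral_cong) auto
  then have "(\<integral>x. f x \<partial>m) = (\<integral>x. max 0 (f x) \<partial>m) - (\<integral>x. max 0 (- f x) \<partial>m)"
    using assms by simp
  ultimately show ?thesis
    unfolding extended_integral_def by (simp add: enn2ereal_ennreal integral_nonneg)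
qed

text \<open>The lower bound makes the negative part integrable, so only the positive part can be infinite.\<close>

lemma extended_integral_finite_imp_integrable:
  assumes [measurable]: "f \<in> borel_measurable m" and ge: "\<And>x. -1 \<le> f x"
    and finite: "extended_integral m f \<noteq> \<infinity>"
  shows "integrable m f"
proof -
  have "(\<integral>\<^sup>+x. ennreal (- f x) \<partial>m) \<le> (\<integral>\<^sup>+x. 1 \<partial>m)"
    using ge by (intro nn_integral_mono) (simp add: minus_le_iff)
  then have neg: "(\<integral>\<^sup>+x. ennreal (- f x) \<partial>m) < \<infinity>"
    by (simp add: emeasure_space_1[simplified] le_less_trans)
  then have pos: "(\<integral>\<^sup>+x. ennreal (f x) \<partial>m) < \<infinity>"
    using finite unfolding extended_integral_def
    by (cases "\<integral>\<^sup>+x. ennreal (- f x) \<partial>m"; cases "\<integral>\<^sup>+x. ennreal (f x) \<partial>m")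
      (auto simp: enn2ereal_ennreal top_ennreal.rep_eq)
  show ?thesis
    using neg pos unfolding real_integrable_def by (simp add: less_top)
qed

text \<open>Densities are unique almost everywhere, so the choice in the definition of the entropy is harmless.\<close>

lemma entropy_functional_density:
  assumes "has_positive_density m \<mu> \<rho>"
  shows "entropy_functional m \<mu> = extended_integral m (\<lambda>x. \<rho> x * ln (\<rho> x))"
proof -
  define \<rho>' where "\<rho>' = (SOME \<rho>. has_positive_density m \<mu> \<rho>)"
  have \<rho>': "has_positive_density m \<mu> \<rho>'"
    unfolding \<rho>'_def by (rule someI[of "has_positive_density m \<mu>", OF assms])
  have "AE x in m. ennreal (\<rho>' x) = ennreal (\<rho> x)"
    using assms \<rho>' unfolding has_positive_density_def has_density_def by (intro density_unique) auto
  moreover have "AE x in m. 0 \<le> \<rho>' x" "AE x in m. 0 \<le> \<rho> x"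
    using assms \<rho>' unfolding has_positive_density_def has_density_def by auto
  ultimately have "AE x in m. \<rho>' x = \<rho> x"
    by eventually_elim simp
  then have "extended_integral m (\<lambda>x. \<rho>' x * ln (\<rho>' x)) = extended_integral m (\<lambda>x. \<rho> x * ln (\<rho> x))"
    unfolding extended_integral_def
    by (intro arg_cong2[where f = "(-)"] arg_cong[where f = enn2ereal] nn_integral_cong_AE) auto
  then show ?thesis
    using assms unfolding entropy_functional_def \<rho>'_def Let_def by auto
qed

lemma free_energy_density:
  assumes \<rho>: "admissible \<rho>" and pos: "AE x in m. 0 < \<rho> x"
  shows "free_energy m W \<gamma> (density m (\<lambda>x. ennreal (\<rho> x))) = ereal (density_energy \<rho>)"
proof -
  note D = admissibleD[OF \<rho>]
  have "has_positive_density m (density m (\<lambda>x. ennreal (\<rho> x))) \<rho>"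
    unfolding has_positive_density_def has_density_def using D(2,6) pos by simp
  then have "entropy_functional m (density m (\<lambda>x. ennreal (\<rho> x))) = ereal (density_entropy \<rho>)"
    using entropy_functional_density extended_integral_eq_integral[OF D(5)]
    by (simp add: density_entropy_def)
  then show ?thesis
    unfolding free_energy_def density_energy_def interaction_energy_density[OF \<rho>]
    by (simp add: inverse_eq_divide)
qed

text \<open>Truncating the density at \<open>0\<close> makes it nonnegative everywhere without changing the measure.\<close>

lemma finite_free_energy_density:
  assumes \<mu>: "\<mu> \<in> prob_measures" and finite: "free_energy m W \<gamma> \<mu> \<noteq> \<infinity>"
  obtains \<rho> where "admissible \<rho>" "AE x in m. 0 < \<rho> x" "\<mu> = density m (\<lambda>x. ennreal (\<rho> x))"
proof -
  have "entropy_functional m \<mu> \<noteq> \<infinity>"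
    using finite gamma_pos unfolding free_energy_def by auto
  then obtain \<rho>' where \<rho>': "has_positive_density m \<mu> \<rho>'"
    unfolding entropy_functional_def by (auto split: if_splits)
  define \<rho> where "\<rho> = (\<lambda>x. max 0 (\<rho>' x))"
  have [measurable]: "\<rho>' \<in> borel_measurable m" and pos': "AE x in m. 0 < \<rho>' x"
    and \<mu>': "\<mu> = density m (\<lambda>x. ennreal (\<rho>' x))"
    using \<rho>' unfolding has_positive_density_def has_density_def by auto
  have [measurable]: "\<rho> \<in> borel_measurable m"
    unfolding \<rho>_def by measurable
  have pos: "AE x in m. 0 < \<rho> x"
    using pos' by eventually_elim (simp add: \<rho>_def)
  have nonneg: "0 \<le> \<rho> x" for x
    by (simp add: \<rho>_def)
  have \<mu>_eq: "\<mu> = density m (\<lambda>x. ennreal (\<rho> x))"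
    unfolding \<mu>' \<rho>_def by (simp add: ennreal_max_0)
  then have "has_positive_density m \<mu> \<rho>"
    unfolding has_positive_density_def has_density_def using pos nonneg by simp
  then have "extended_integral m (\<lambda>x. \<rho> x * ln (\<rho> x)) \<noteq> \<infinity>"
    using \<open>entropy_functional m \<mu> \<noteq> \<infinity>\<close> entropy_functional_density by simp
  then have entropy: "integrable m (\<lambda>x. \<rho> x * ln (\<rho> x))"
    by (intro extended_integral_finite_imp_integrable entropy_density_ge nonneg) simp_all
  have "emeasure \<mu> (space \<mu>) = 1"
    using \<mu> prob_space.emeasure_space_1 unfolding prob_measures_def by blast
  then have mass: "(\<integral>\<^sup>+x. ennreal (\<rho> x) \<partial>m) = 1"
    unfolding \<mu>_eq by (simp add: emeasure_density)
  then have int: "integrable m \<rho>"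
    using nonneg by (intro integrableI_nonneg) simp_all
  then have "(\<integral>x. \<rho> x \<partial>m) = 1"
    using mass nonneg by (simp add: integral_eq_nn_integral)
  then have "admissible \<rho>"
    unfolding admissible_def using int nonneg entropy by simp
  then show ?thesis
    using that pos \<mu>_eq by blast
qed

lemma free_energy_ge_minimum:
  assumes min: "minimizing_density \<rho>" and \<mu>: "\<mu> \<in> prob_measures"
  shows "ereal (density_energy \<rho>) \<le> free_energy m W \<gamma> \<mu>"
proof (cases "free_energy m W \<gamma> \<mu> = \<infinity>")
  case False
  then obtain \<sigma> where "admissible \<sigma>" "AE x in m. 0 < \<sigma> x" "\<mu> = density m (\<lambda>x. ennreal (\<sigma> x))"
    by (rule finite_free_energy_density[OF \<mu>])
  then show ?thesis
    using min free_energy_density unfolding minimizing_density_def by simp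
qed simp

lemma free_energy_minimizer_exists:
  "\<exists>\<mu>. is_arg_min (free_energy m W \<gamma>) (\<lambda>\<mu>. \<mu> \<in> prob_measures) \<mu>"
proof -
  obtain \<rho> where min: "minimizing_density \<rho>"
    using minimizing_density_exists by blast
  then have \<rho>: "admissible \<rho>"
    unfolding minimizing_density_def by blast
  have "free_energy m W \<gamma> (density m (\<lambda>x. ennreal (\<rho> x))) = ereal (density_energy \<rho>)"
    using free_energy_density[OF \<rho> minimizing_density_pos[OF min]] .
  then have "is_arg_min (free_energy m W \<gamma>) (\<lambda>\<mu>. \<mu> \<in> prob_measures) (density m (\<lambda>x. ennreal (\<rho> x)))"
    unfolding is_arg_min_def using prob_measures_density[OF \<rho>] free_energy_ge_minimum[OF min]
    by (simp add: not_less)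
  then show ?thesis
    by blast
qed

text \<open>A minimizer in the space of measures has a positive density. That density also minimizes in the larger
  class of nonnegative densities, since the minimizing densities there are positive too, so the
  bound on Gibbs densities applies to it.\<close>

lemma free_energy_minimizer_density:
  assumes "is_arg_min (free_energy m W \<gamma>) (\<lambda>\<mu>. \<mu> \<in> prob_measures) \<mu>"
  shows "\<exists>\<rho>. has_density m \<mu> \<rho> \<and> integrable m (\<lambda>x. (\<rho> x)\<^sup>2)"
proof -
  obtain \<rho>0 where min0: "minimizing_density \<rho>0"
    using minimizing_density_exists by blast
  then have \<rho>0: "admissible \<rho>0"
    unfolding minimizing_density_def by blast
  have \<mu>: "\<mu> \<in> prob_measures"
    using assms unfolding is_arg_min_def by blast
  have "free_energy m W \<gamma> \<mu> \<le> free_energy m W \<gamma> (density m (\<lambda>x. ennreal (\<rho>0 x)))"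
    using assms prob_measures_density[OF \<rho>0] unfolding is_arg_min_def by (meson not_less)
  then have le: "free_energy m W \<gamma> \<mu> \<le> ereal (density_energy \<rho>0)"
    using free_energy_density[OF \<rho>0 minimizing_density_pos[OF min0]] by simp
  then have "free_energy m W \<gamma> \<mu> \<noteq> \<infinity>"
    by auto
  then obtain \<rho> where \<rho>: "admissible \<rho>" "AE x in m. 0 < \<rho> x" "\<mu> = density m (\<lambda>x. ennreal (\<rho> x))"
    by (rule finite_free_energy_density[OF \<mu>])
  have "density_energy \<rho> \<le> density_energy \<rho>0"
    using le free_energy_density[OF \<rho>(1,2)] \<rho>(3) by simp
  then have "minimizing_density \<rho>"
    using min0 \<rho>(1) unfolding minimizing_density_def by (meson order_trans)
  then have "integrable m (\<lambda>x. (\<rho> x)\<^sup>2)"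
    by (rule minimizing_density_square_integrable)
  moreover have "has_density m \<mu> \<rho>"
    unfolding has_density_def using admissibleD(2,6)[OF \<rho>(1)] \<rho>(3) by simp
  ultimately show ?thesis
    by blast
qed

end

theorem theorem2p8:
  fixes \<A> :: "('a::{t2_space, second_countable_topology}, 'n::finite) chart set"
    and g :: "('a, 'n) chart \<Rightarrow> 'a \<Rightarrow> real ^ 'n ^ 'n"
    and vol m :: "'a measure"
    and W :: "'a \<times> 'a \<Rightarrow> real"
    and \<gamma> :: real
  assumes manifold: "compact_connected_riemannian_manifold \<A> g"
    and volume: "is_riemannian_volume \<A> g vol"
    and m: "m = normalized_measure vol"
    and gamma: "\<gamma> > 0"
    and W_cont: "continuous_on UNIV W"
    and W_sym: "\<And>x y. W (x, y) = W (y, x)"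
  shows "(\<exists>\<mu>. is_arg_min (free_energy m W \<gamma>) (\<lambda>\<mu>. \<mu> \<in> prob_measures) \<mu>) \<and>
    (\<forall>\<mu>. is_arg_min (free_energy m W \<gamma>) (\<lambda>\<mu>. \<mu> \<in> prob_measures) \<mu> \<longrightarrow>
       (\<exists>\<rho>. has_density m \<mu> \<rho> \<and> integrable m (\<lambda>x. (\<rho> x)\<^sup>2)))"
proof -
  interpret mean_field m W \<gamma>
    unfolding mean_field_def mean_field_axioms_def m
    using normalized_riemannian_volume[OF manifold volume] manifold gamma W_cont W_sym
    unfolding compact_connected_riemannian_manifold_def by blast
  show ?thesis
    using free_energy_minimizer_exists free_energy_minimizer_density by blast
qed

end
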